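(* Let $r\ge1$, $\delta\ge2$, $m\ge1$ be integers, $\ell$ a positive integer with $\ell\le m$, and set $$n_L=r+\delta-1,\quad \alpha=d=n_L-1,\quad \beta=1,\quad K_L=r\alpha-\binom r2,\quad N_L=\binom{n_L}{2},\quad \Delta_L=N_L-K_L+1 .$$ Let $\mathcal{A}$ be a scalar linear code over $\mathbb{F}_q$ with $(K_L,\Delta_L)$ all-symbol locality, length $mN_L$ and dimension $\ell K_L$, which is optimal with respect to minimum distance, so that it is composed of $m$ support-disjoint local $[N_L,K_L,\Delta_L]$ MDS codes $\mathcal{A}_1,\dots,\mathcal{A}_m$ and has parameters $[mN_L,\ \ell K_L,\ \Delta_L+(m-\ell)N_L]$. Let $\mathcal{C}$ be the vector code over $\mathbb{F}_q$ with vector-size parameter $\alpha$ obtained from $\mathcal{A}$ as follows: for each $i\in[m]$ the $N_L$ code symbols of $\mathcal{A}_i$ are placed bijectively on the edges of a complete graph on $n_L$ vertices, giving $n_L$ vector symbols (nodes), each node storing the $\alpha=n_L-1$ symbols on its incident edges. Then $\mathcal{C}$ is an MBR-local code with $(r,\delta)$ all-symbol locality composed of $m$ support-disjoint local codes $\{\mathcal{C}_i\}_{i=1}^m$, each of which is a repair-by-transfer $((n_L,r,d),(\alpha,\beta),K_L)$ MBR code. Moreover $\mathcal{C}$ has length $n=mn_L$, scalar dimension $K=\ell K_L$, and minimum distance $$d_{\min}=n-\frac{K}{K_L}r+1-\left(\frac{K}{K_L}-1\right)(\delta-1)=(m-\ell)n_L+\delta .$$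
   Context: Scalar locality. A scalar linear code $\mathcal{A}$ of length $N$ and dimension $k$ has $(r',\delta')$ all-symbol locality if there are sets $S_i$ covering $[N]$ with $|S_i|\le r'+\delta'-1$ and $d_{\min}(\mathcal{A}|_{S_i})\ge\delta'$, where $\mathcal{A}|_S$ is the restriction to coordinates $S$. It is optimal if its minimum distance equals $N-k+1-(\lceil k/r'\rceil-1)(\delta'-1)$. Vector codes. An $\mathbb{F}_q$-linear vector code of block length $n$ with vector-size parameter $\alpha$ is an $\mathbb{F}_q$-linear subspace $\mathcal{C}$ of $(\mathbb{F}_q^\alpha)^n$; its scalar dimension is $K=\dim_{\mathbb{F}_q}\mathcal{C}$; $G$ is a $K\times n\alpha$ generator matrix of the expanded scalar code, the $i$-th thick column being the $\alpha$ columns of the $i$-th vector symbol. Standing assumption: the $\alpha$ columns in each thick column are linearly independent. $G|_S$ and $\mathcal{C}|_S$ denote restriction to thick columns/vector symbols in $S\subseteq[n]$. $d_{\min}$ is the minimum Hamming weight, counted in vector symbols, of a nonzero codeword. MBR codes. A linear exact-repair $((n,k,d),(\alpha,\beta),B)$ regenerating code ($k\le d\le n-1$) is a vector code of block length $n$, vector-size parameter $\alpha$, scalar dimension $B$ such that (i) every codeword is determined by any $k$ of its vector symbols; (ii) for every $i$ and every $D\subseteq[n]\setminus\{i\}$, $|D|=d$, there are $\mathbb{F}_q$-linear maps $\varphi_h:\mathbb{F}_q^\alpha\to\mathbb{F}_q^\beta$, $h\in D$, such that $\mathbf{c}_i$ is determined by $(\varphi_h(\mathbf{c}_h))_{h\in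 D}$ for every codeword $\mathbf{c}$. It is an MBR code if $\alpha=d\beta$ and $B=\sum_{i=0}^{k-1}(d-i)\beta$. The repair-by-transfer MBR code with $d=n-1$, $\alpha=n-1$, $\beta=1$, $B=dk-\binom k2$ is obtained by encoding $B$ message symbols with a scalar MDS code of length $\binom n2$ and dimension $B$, placing the code symbols on distinct edges of the complete graph on $n$ vertices, and letting each vertex (node) store the symbols on its incident edges. MBR-local codes. $\mathcal{C}$ has exact $(r,\delta)$ information locality if there are sets $S_i\subseteq[n]$, $i\in\mathcal{L}$, with $|S_i|=r+\delta-1$, $d_{\min}(\mathcal{C}|_{S_i})=\delta$ and $\mathrm{Rank}(G|_{\cup_iS_i})=K$. Such a code is an MBR-local code with $(r,\delta)$ all-symbol locality if it can be punctured to yield $m$ local codes $\mathcal{C}|_{S_i}$, each an $(n_L,r,d)$-MBR code with $n_L=r+\delta-1$, with $\mathrm{Rank}(G|_{\cup_{i=1}^mS_i})=K$ and $\cup_{i=1}^mS_i=[n]$. *)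

theory Defs
  imports Complex_Main "HOL-Library.Function_Algebras" "HOL-Library.Disjoint_Sets"
begin

text \<open>
  A word over the field \<open>'f\<close> with coordinates in a finite set \<open>X\<close> of elements of \<open>'i\<close> is a
  function \<open>'i \<Rightarrow> 'f\<close> vanishing outside \<open>X\<close>, so words of all lengths, and their restrictions,
  live in one vector space.
\<close>

definition fscale :: "'f::field \<Rightarrow> ('i \<Rightarrow> 'f) \<Rightarrow> 'i \<Rightarrow> 'f" where
  "fscale c x = (\<lambda>i. c * x i)"

global_interpretation fvec: vector_space "fscale :: 'f::field \<Rightarrow> ('i \<Rightarrow> 'f) \<Rightarrow> 'i \<Rightarrow> 'f"
  by unfold_locales (auto simp: fscale_def fun_eq_iff algebra_simps)

definition words :: "'i set \<Rightarrow> ('i \<Rightarrow> 'f::field) set" where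
  "words X = {c. \<forall>i. i \<notin> X \<longrightarrow> c i = 0}"

definition puncture :: "('i \<Rightarrow> 'f::field) set \<Rightarrow> 'i set \<Rightarrow> ('i \<Rightarrow> 'f) set" where
  "puncture C S = (\<lambda>c i. if i \<in> S then c i else 0) ` C"

text \<open>
  The zero code has no minimum distance; the value 0 makes a bound \<open>\<ge> \<delta>\<close> with \<open>\<delta> \<ge> 1\<close>
  fail for it.
\<close>

definition min_weight :: "(('i \<Rightarrow> 'f::field) \<Rightarrow> nat) \<Rightarrow> ('i \<Rightarrow> 'f) set \<Rightarrow> nat" where
  "min_weight w C = (if C \<subseteq> {0} then 0 else Inf (w ` (C - {0})))"


subsection \<open>Scalar codes\<close>

definition linear_code :: "'i set \<Rightarrow> ('i \<Rightarrow> 'f::field) set \<Rightarrow> bool" where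
  "linear_code X C \<longleftrightarrow> finite X \<and> fvec.subspace C \<and> C \<subseteq> words X"

definition dmin :: "('i \<Rightarrow> 'f::field) set \<Rightarrow> nat" where
  "dmin = min_weight (\<lambda>c. card {i. c i \<noteq> 0})"

definition mds_code :: "'i set \<Rightarrow> nat \<Rightarrow> ('i \<Rightarrow> 'f::field) set \<Rightarrow> bool" where
  "mds_code X k C \<longleftrightarrow>
     linear_code X C \<and> fvec.dim C = k \<and> k \<le> card X \<and> dmin C = card X - k + 1"

definition all_symbol_locality :: "nat \<Rightarrow> nat \<Rightarrow> 'i set \<Rightarrow> ('i \<Rightarrow> 'f::field) set \<Rightarrow> bool" where
  "all_symbol_locality r \<delta> X C \<longleftrightarrow>
     (\<exists>\<S>. \<Union>\<S> = X \<and> (\<forall>S\<in>\<S>. card S \<le> r + \<delta> - 1 \<and> dmin (puncture C S) \<ge> \<delta>))"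

definition optimal_all_symbol_locality ::
  "nat \<Rightarrow> nat \<Rightarrow> 'i set \<Rightarrow> ('i \<Rightarrow> 'f::field) set \<Rightarrow> bool" where
  "optimal_all_symbol_locality r \<delta> X C \<longleftrightarrow>
     all_symbol_locality r \<delta> X C \<and>
     int (dmin C) = int (card X) - int (fvec.dim C) + 1
        - (\<lceil>real (fvec.dim C) / real r\<rceil> - 1) * (int \<delta> - 1)"

definition mds_decomposition ::
  "nat \<Rightarrow> nat \<Rightarrow> nat \<Rightarrow> nat \<Rightarrow> 'i set \<Rightarrow> ('i \<Rightarrow> 'f::field) set \<Rightarrow> (nat \<Rightarrow> 'i set) \<Rightarrow> bool" where
  "mds_decomposition m N k \<Delta> X C P \<longleftrightarrow>
     (\<Union>i<m. P i) = X \<and> disjoint_family_on P {..<m} \<and>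
     (\<forall>i<m. card (P i) = N \<and> mds_code (P i) k (puncture C (P i)) \<and>
            dmin (puncture C (P i)) = \<Delta>)"


subsection \<open>Vector codes\<close>

text \<open>
  A vector code with vector symbols (nodes) in \<open>V\<close> and vector size \<open>\<alpha>\<close> is given by its expanded
  scalar code, whose coordinates are the pairs \<open>(v, j)\<close> with \<open>v \<in> V\<close> and \<open>j < \<alpha>\<close>; its block
  length is \<open>card V\<close>.
\<close>

definition symb :: "('v \<times> nat \<Rightarrow> 'f::field) \<Rightarrow> 'v \<Rightarrow> nat \<Rightarrow> 'f" where
  "symb c v = (\<lambda>j. c (v, j))"

definition vpuncture :: "('v \<times> nat \<Rightarrow> 'f::field) set \<Rightarrow> 'v set \<Rightarrow> ('v \<times> nat \<Rightarrow> 'f) set" where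
  "vpuncture C S = puncture C (S \<times> UNIV)"

definition vdmin :: "('v \<times> nat \<Rightarrow> 'f::field) set \<Rightarrow> nat" where
  "vdmin = min_weight (\<lambda>c. card {v. symb c v \<noteq> 0})"

definition indep_family :: "('a \<Rightarrow> 'i \<Rightarrow> 'f::field) \<Rightarrow> 'a set \<Rightarrow> bool" where
  "indep_family f J \<longleftrightarrow> inj_on f J \<and> fvec.independent (f ` J)"

text \<open>The rows \<open>G j\<close>, \<open>j < K\<close>, of a generator matrix form a basis of the code.\<close>

definition gen_matrix :: "nat \<Rightarrow> (nat \<Rightarrow> 'i \<Rightarrow> 'f::field) \<Rightarrow> ('i \<Rightarrow> 'f) set \<Rightarrow> bool" where
  "gen_matrix K G C \<longleftrightarrow> indep_family G {..<K} \<and> fvec.span (G ` {..<K}) = C"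

definition gcol :: "nat \<Rightarrow> (nat \<Rightarrow> 'i \<Rightarrow> 'f::field) \<Rightarrow> 'i \<Rightarrow> nat \<Rightarrow> 'f" where
  "gcol K G x = (\<lambda>j. if j < K then G j x else 0)"

definition thick_rank :: "nat \<Rightarrow> nat \<Rightarrow> (nat \<Rightarrow> 'v \<times> nat \<Rightarrow> 'f::field) \<Rightarrow> 'v set \<Rightarrow> nat" where
  "thick_rank \<alpha> K G S = fvec.dim (gcol K G ` (S \<times> {..<\<alpha>}))"

text \<open>
  The last conjunct is the standing assumption on thick columns. Here and in the rank condition
  below, the choice of the generator matrix does not matter: any two differ by an invertible
  row transformation.
\<close>

definition vector_code :: "'v set \<Rightarrow> nat \<Rightarrow> ('v \<times> nat \<Rightarrow> 'f::field) set \<Rightarrow> bool" where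
  "vector_code V \<alpha> C \<longleftrightarrow> finite V \<and> linear_code (V \<times> {..<\<alpha>}) C \<and>
     (\<exists>G. gen_matrix (fvec.dim C) G C \<and>
          (\<forall>v\<in>V. indep_family (gcol (fvec.dim C) G) ({v} \<times> {..<\<alpha>})))"

text \<open>
  The repair maps \<open>\<phi> h\<close> are linear maps from \<open>words {..<\<alpha>}\<close> to \<open>words {..<\<beta>}\<close>, that is, from
  the \<open>\<alpha>\<close>-dimensional to the \<open>\<beta>\<close>-dimensional coordinate space; every such map extends
  linearly to all of \<open>nat \<Rightarrow> 'f\<close>, so asking for global linearity is no restriction.
\<close>

definition regenerating_code ::
  "nat \<Rightarrow> nat \<Rightarrow> nat \<Rightarrow> nat \<Rightarrow> nat \<Rightarrow> nat \<Rightarrow> 'v set \<Rightarrow> ('v \<times> nat \<Rightarrow> 'f::field) set \<Rightarrow> bool" where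
  "regenerating_code n k d \<alpha> \<beta> B V C \<longleftrightarrow>
     vector_code V \<alpha> C \<and> card V = n \<and> k \<le> d \<and> d < n \<and> fvec.dim C = B \<and>
     (\<forall>S\<subseteq>V. card S = k \<longrightarrow>
        (\<forall>c\<in>C. \<forall>c'\<in>C. (\<forall>v\<in>S. symb c v = symb c' v) \<longrightarrow> c = c')) \<and>
     (\<forall>i\<in>V. \<forall>D\<subseteq>V - {i}. card D = d \<longrightarrow>
        (\<exists>\<phi> :: 'v \<Rightarrow> (nat \<Rightarrow> 'f) \<Rightarrow> (nat \<Rightarrow> 'f).
           (\<forall>h\<in>D. Vector_Spaces.linear fscale fscale (\<phi> h) \<and>
                  \<phi> h ` words {..<\<alpha>} \<subseteq> words {..<\<beta>}) \<and>
           (\<forall>c\<in>C. \<forall>c'\<in>C. (\<forall>h\<in>D. \<phi> h (symb c h) = \<phi> h (symb c' h)) \<longrightarrow>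
                              symb c i = symb c' i)))"

definition MBR_code ::
  "nat \<Rightarrow> nat \<Rightarrow> nat \<Rightarrow> nat \<Rightarrow> nat \<Rightarrow> nat \<Rightarrow> 'v set \<Rightarrow> ('v \<times> nat \<Rightarrow> 'f::field) set \<Rightarrow> bool" where
  "MBR_code n k d \<alpha> \<beta> B V C \<longleftrightarrow>
     regenerating_code n k d \<alpha> \<beta> B V C \<and> \<alpha> = d * \<beta> \<and> B = (\<Sum>i<k. (d - i) * \<beta>)"

definition exact_information_locality ::
  "nat \<Rightarrow> nat \<Rightarrow> 'v set \<Rightarrow> nat \<Rightarrow> ('v \<times> nat \<Rightarrow> 'f::field) set \<Rightarrow> 'l set \<Rightarrow> ('l \<Rightarrow> 'v set) \<Rightarrow> bool" where
  "exact_information_locality r \<delta> V \<alpha> C L S \<longleftrightarrow>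
     vector_code V \<alpha> C \<and>
     (\<forall>i\<in>L. S i \<subseteq> V \<and> card (S i) = r + \<delta> - 1 \<and> vdmin (vpuncture C (S i)) = \<delta>) \<and>
     (\<exists>G. gen_matrix (fvec.dim C) G C \<and>
          thick_rank \<alpha> (fvec.dim C) G (\<Union>i\<in>L. S i) = fvec.dim C)"

text \<open>
  All-symbol MBR-locality, witnessed by the local codes on \<open>S 0, \<dots>, S (m - 1)\<close>; \<open>d\<close>, \<open>\<beta>\<close> and
  \<open>B\<close> are the remaining parameters of these MBR codes.
\<close>

definition MBR_local_code ::
  "nat \<Rightarrow> nat \<Rightarrow> nat \<Rightarrow> nat \<Rightarrow> nat \<Rightarrow> 'v set \<Rightarrow> nat \<Rightarrow> ('v \<times> nat \<Rightarrow> 'f::field) set \<Rightarrow>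
     nat \<Rightarrow> (nat \<Rightarrow> 'v set) \<Rightarrow> bool" where
  "MBR_local_code r \<delta> d \<beta> B V \<alpha> C m S \<longleftrightarrow>
     exact_information_locality r \<delta> V \<alpha> C {..<m} S \<and>
     (\<forall>i<m. MBR_code (r + \<delta> - 1) r d \<alpha> \<beta> B (S i) (vpuncture C (S i))) \<and>
     (\<Union>i<m. S i) = V"


subsection \<open>Storing code symbols on the edges of complete graphs\<close>

definition complete_edges :: "'v set \<Rightarrow> 'v set set" where
  "complete_edges V = {e. e \<subseteq> V \<and> card e = 2}"

text \<open>
  \<open>pl e\<close> is the scalar coordinate placed on the edge \<open>e\<close>, and \<open>slot v j\<close> is the edge at \<open>v\<close>
  whose symbol is the \<open>j\<close>-th component of node \<open>v\<close>; any order of the incident edges is allowed.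
\<close>

definition edge_placement ::
  "'v set \<Rightarrow> 'i set \<Rightarrow> ('v set \<Rightarrow> 'i) \<Rightarrow> ('v \<Rightarrow> nat \<Rightarrow> 'v set) \<Rightarrow> bool" where
  "edge_placement V X pl slot \<longleftrightarrow>
     bij_betw pl (complete_edges V) X \<and>
     (\<forall>v\<in>V. bij_betw (slot v) {..<card V - 1} {e \<in> complete_edges V. v \<in> e})"

definition node_code ::
  "'v set \<Rightarrow> nat \<Rightarrow> ('v set \<Rightarrow> 'i) \<Rightarrow> ('v \<Rightarrow> nat \<Rightarrow> 'v set) \<Rightarrow>
     ('i \<Rightarrow> 'f::field) set \<Rightarrow> ('v \<times> nat \<Rightarrow> 'f) set" where
  "node_code V \<alpha> pl slot A =
     (\<lambda>a (v, j). if v \<in> V \<and> j < \<alpha> then a (pl (slot v j)) else 0) ` A"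

definition repair_by_transfer_code ::
  "nat \<Rightarrow> nat \<Rightarrow> 'v set \<Rightarrow> ('v \<times> nat \<Rightarrow> 'f::field) set \<Rightarrow> bool" where
  "repair_by_transfer_code n k V C \<longleftrightarrow> finite V \<and> card V = n \<and>
     (\<exists>(X :: nat set) M pl slot.
        card X = n choose 2 \<and> mds_code X ((n - 1) * k - (k choose 2)) M \<and>
        edge_placement V X pl slot \<and> C = node_code V (n - 1) pl slot M)"

end

theory Submission
  imports Defs
begin

text \<open>
  Decomposition. Write \<open>K\<close>, \<open>\<Delta>\<close> for the scalar locality parameters. Adjoining to a coordinate set
  a local set that raises its rank by \<open>\<rho> > 0\<close> adds at least \<open>\<rho> + \<Delta> - 1\<close> coordinates. A set of
  less than full rank misses at least \<open>dmin\<close> coordinates, so optimality forces every local set to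
  have rank \<open>K\<close> and size \<open>K + \<Delta> - 1\<close>, and any two to be disjoint, unless the code is MDS, where
  any partition will do.

  Minimum distance. A nonzero code symbol sits on an edge between two nonzero nodes. If \<open>w i\<close> nodes
  of the \<open>i\<close>-th graph are nonzero, the scalar codeword therefore has weight at most
  \<open>\<Sum>i. w i choose 2\<close>; by convexity, too few nonzero nodes would contradict the scalar minimum
  distance. Conversely, \<open>l - 1\<close> whole graphs and \<open>r - 1\<close> nodes of one more have rank less than the
  dimension, so some nonzero codeword vanishes there. A local code is the case \<open>m = l = 1\<close>.
\<close>

section \<open>Linear algebra of words\<close>

global_interpretation fvec_pair: vector_space_pair
  "fscale :: 'f::field \<Rightarrow> ('i \<Rightarrow> 'f) \<Rightarrow> 'i \<Rightarrow> 'f" "fscale :: 'f::field \<Rightarrow> ('j \<Rightarrow> 'f) \<Rightarrow> 'j \<Rightarrow> 'f"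
  by unfold_locales

definition restr :: "'i set \<Rightarrow> ('i \<Rightarrow> 'f::field) \<Rightarrow> 'i \<Rightarrow> 'f" where
  "restr S c = (\<lambda>i. if i \<in> S then c i else 0)"

definition unit_word :: "'i \<Rightarrow> 'i \<Rightarrow> 'f::field" where
  "unit_word x = (\<lambda>i. if i = x then 1 else 0)"

lemma puncture_eq: "puncture C S = restr S ` C"
  by (auto simp: puncture_def restr_def)

lemma fvec_linearI:
  assumes "\<And>x y. f (x + y) = f x + f y" "\<And>c x. f (fscale c x) = fscale c (f x)"
  shows "Vector_Spaces.linear fscale fscale (f :: ('i \<Rightarrow> 'f::field) \<Rightarrow> 'j \<Rightarrow> 'f)"
  by (rule Vector_Spaces.linear.intro[OF fvec.vector_space_axioms fvec.vector_space_axioms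
        module_hom.intro[OF fvec.module_axioms fvec.module_axioms]])
     (unfold_locales, auto simp: assms)

lemma linear_restr: "Vector_Spaces.linear fscale fscale (restr S)"
  by (rule fvec_linearI) (auto simp: restr_def fscale_def fun_eq_iff)

lemma subspace_words: "fvec.subspace (words X)"
  by (auto simp: fvec.subspace_def words_def fscale_def)

lemma subspace_linear_image:
  fixes f :: "('i \<Rightarrow> 'f::field) \<Rightarrow> 'j \<Rightarrow> 'f"
  assumes "Vector_Spaces.linear fscale fscale f" "fvec.subspace C"
  shows "fvec.subspace (f ` C)"
  using assms by (rule fvec_pair.linear_subspace_image)

text \<open>Injectivity is asked for on \<open>C\<close> only: restrictions and the passage to node
  words are injective on the code at hand, but need not be so globally.\<close>

lemma dim_linear_inj_image:
  fixes f :: "('i \<Rightarrow> 'f::field) \<Rightarrow> 'j \<Rightarrow> 'f"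
  assumes lin: "Vector_Spaces.linear fscale fscale f" and C: "fvec.subspace C" and inj: "inj_on f C"
  shows "fvec.dim (f ` C) = fvec.dim C"
proof -
  obtain B where B: "B \<subseteq> C" "fvec.independent B" "C \<subseteq> fvec.span B" "card B = fvec.dim C"
    using fvec.basis_exists by blast
  have sp: "fvec.span B = C"
    using B C by (simp add: fvec.span_minimal subset_antisym)
  have "fvec.independent (f ` B)"
    using lin B(2) inj sp by (intro fvec_pair.linear_independent_injective_image) auto
  moreover have "f ` C \<subseteq> fvec.span (f ` B)"
    using fvec_pair.linear_span_image[OF lin, of B] sp by simp
  moreover have "card (f ` B) = card B"
    using inj B(1) by (meson card_image inj_on_subset)
  ultimately show ?thesis
    using B by (intro fvec.dim_unique[of "f ` B"]) auto
qed

lemma word_eq_sum_unit_words: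
  assumes "finite X" "c \<in> words X"
  shows "c \<in> fvec.span (unit_word ` X)"
  using assms
proof (induction X arbitrary: c rule: finite_induct)
  case empty
  then have "c = 0" by (auto simp: words_def fun_eq_iff)
  then show ?case by (simp only: fvec.span_zero)
next
  case (insert x X)
  have "restr X c \<in> fvec.span (unit_word ` X)"
    using insert by (auto simp: words_def restr_def)
  then have "restr X c \<in> fvec.span (unit_word ` insert x X)"
    using fvec.span_mono[of "unit_word ` X" "unit_word ` insert x X"] by blast
  moreover have "fscale (c x) (unit_word x) \<in> fvec.span (unit_word ` insert x X)"
    by (intro fvec.span_scale fvec.span_base) auto
  moreover have "c = restr X c + fscale (c x) (unit_word x)"
    using insert by (auto simp: fun_eq_iff restr_def fscale_def unit_word_def words_def)
  ultimately show ?case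
    using fvec.span_add by fastforce
qed

lemma words_subset_if_unit_words:
  assumes "finite X" "fvec.subspace C" "\<And>x. x \<in> X \<Longrightarrow> unit_word x \<in> C"
  shows "words X \<subseteq> C"
proof
  fix c :: "'a \<Rightarrow> 'b" assume "c \<in> words X"
  then have "c \<in> fvec.span (unit_word ` X)"
    using assms(1) by (rule word_eq_sum_unit_words[rotated])
  moreover have "fvec.span (unit_word ` X) \<subseteq> C"
    using assms by (intro fvec.span_minimal) auto
  ultimately show "c \<in> C" by blast
qed

section \<open>Independence of columns of a generator matrix\<close>

lemma sum_fun_apply: "(\<Sum>x\<in>A. f x) i = (\<Sum>x\<in>A. f x i)"
  by (induction A rule: infinite_finite_induct) auto

lemma span_linear_functional:
  fixes c :: "'i \<Rightarrow> 'f::field"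
  assumes "c \<in> fvec.span B" "\<And>b. b \<in> B \<Longrightarrow> (\<Sum>x\<in>J. \<mu> x * b x) = 0"
  shows "(\<Sum>x\<in>J. \<mu> x * c x) = 0"
proof -
  have "fvec.subspace {c. (\<Sum>x\<in>J. \<mu> x * c x) = 0}"
    by (auto simp: fvec.subspace_def fscale_def algebra_simps sum.distrib
        simp flip: sum_distrib_left)
  then have "fvec.span B \<subseteq> {c. (\<Sum>x\<in>J. \<mu> x * c x) = 0}"
    using assms(2) by (intro fvec.span_minimal) auto
  then show ?thesis using assms(1) by blast
qed

text \<open>A linear relation between the columns at \<open>J\<close> is a functional that kills the whole code.\<close>

lemma indep_columns:
  fixes C :: "('i \<Rightarrow> 'f::field) set"
  assumes G: "gen_matrix K G C" and J: "finite J" and full: "words J \<subseteq> puncture C J"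
  shows "indep_family (gcol K G) J"
proof -
  \<comment> \<open>Fullness gives a codeword that looks like the unit vector at \<open>x\<close> on
    \<open>J\<close>. Evaluated there, a relation between columns reduces to its coefficient at
    \<open>x\<close>.\<close>
  have ex: "\<exists>c\<in>C. \<forall>y\<in>J. c y = (if y = x then 1 else 0)" if "x \<in> J" for x
  proof -
    have "(unit_word x :: 'i \<Rightarrow> 'f) \<in> words J"
      using that by (auto simp: unit_word_def words_def)
    then obtain c where "c \<in> C" "unit_word x = restr J c"
      using full by (auto simp: puncture_eq)
    then show ?thesis
      by (intro bexI[of _ c]) (auto simp: unit_word_def restr_def fun_eq_iff split: if_splits)
  qed
  have relation: "\<mu> x = 0"
    if rel: "\<And>j. j < K \<Longrightarrow> (\<Sum>x\<in>J. \<mu> x * G j x) = 0" and x: "x \<in> J" for \<mu> :: "'i \<Rightarrow> 'f" and x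
  proof -
    obtain c where c: "c \<in> C" "\<forall>y\<in>J. c y = (if y = x then 1 else 0)" using ex x by blast
    have "c \<in> fvec.span (G ` {..<K})" using G c by (simp add: gen_matrix_def)
    then have "(\<Sum>y\<in>J. \<mu> y * c y) = 0"
      by (rule span_linear_functional) (use rel in auto)
    moreover have "(\<Sum>y\<in>J. \<mu> y * c y) = (\<Sum>y\<in>J. if y = x then \<mu> y else 0)"
      using c by (intro sum.cong) auto
    ultimately show ?thesis using x J by simp
  qed
  have inj: "inj_on (gcol K G) J"
  proof (rule inj_onI, rule ccontr)
    fix x y assume xy: "x \<in> J" "y \<in> J" "gcol K G x = gcol K G y" "x \<noteq> y"
    \<comment> \<open>Equal columns at distinct positions are a relation with coefficients 1 and
      -1.\<close>
    define \<mu> :: "'i \<Rightarrow> 'f" where "\<mu> z = (if z = x then 1 else if z = y then -1 else 0)" for z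
    have "(\<Sum>z\<in>J. \<mu> z * G j z) = 0" if "j < K" for j
    proof -
      have "(\<Sum>z\<in>J. \<mu> z * G j z) = (\<Sum>z\<in>{x, y}. \<mu> z * G j z)"
        using xy J by (intro sum.mono_neutral_right) (auto simp: \<mu>_def)
      also have "\<dots> = G j x - G j y" using xy by (simp add: \<mu>_def)
      also have "\<dots> = 0" using fun_cong[OF xy(3), of j] that by (simp add: gcol_def)
      finally show ?thesis .
    qed
    from relation[OF this xy(1)] show False by (simp add: \<mu>_def)
  qed
  moreover have "fvec.independent (gcol K G ` J)"
  proof (rule fvec.independent_if_scalars_zero)
    show "finite (gcol K G ` J)" using J by simp
    fix f v assume f: "(\<Sum>v\<in>gcol K G ` J. fscale (f v) v) = 0" and v: "v \<in> gcol K G ` J"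
    then obtain x where x: "x \<in> J" "v = gcol K G x" by blast
    have "(\<Sum>x\<in>J. f (gcol K G x) * G j x) = 0" if "j < K" for j
    proof -
      have "(\<Sum>x\<in>J. fscale (f (gcol K G x)) (gcol K G x)) = 0"
        using f by (simp add: sum.reindex[OF inj])
      from fun_cong[OF this, of j] show ?thesis
        using that by (simp add: sum_fun_apply fscale_def gcol_def)
    qed
    from relation[OF this x(1)] show "f v = 0" using x by simp
  qed
  ultimately show ?thesis by (simp add: indep_family_def)
qed

section \<open>Bases and dimensions of linear codes\<close>

lemma dim_words:
  assumes "finite X"
  shows "fvec.dim (words X :: ('i \<Rightarrow> 'f::field) set) = card X"
proof -
  have inj: "inj_on (unit_word :: 'i \<Rightarrow> 'i \<Rightarrow> 'f) X"
    by (rule inj_onI) (auto simp: unit_word_def fun_eq_iff split: if_splits)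
  have "fvec.independent ((unit_word :: 'i \<Rightarrow> 'i \<Rightarrow> 'f) ` X)"
  proof (rule fvec.independent_if_scalars_zero)
    show "finite (unit_word ` X)" using assms by simp
    fix f :: "('i \<Rightarrow> 'f) \<Rightarrow> 'f" and v :: "'i \<Rightarrow> 'f"
    assume f: "(\<Sum>v\<in>unit_word ` X. fscale (f v) v) = 0" and v: "v \<in> unit_word ` X"
    then obtain x where x: "x \<in> X" "v = unit_word x" by blast
    have "(\<Sum>y\<in>X. fscale (f (unit_word y)) (unit_word y)) = 0"
      using f by (simp add: sum.reindex[OF inj])
    from fun_cong[OF this, of x] have "(\<Sum>y\<in>X. if x = y then f (unit_word y) else 0) = 0"
      by (simp add: sum_fun_apply fscale_def unit_word_def if_distrib cong: if_cong)
    then show "f v = 0" using x assms by simp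
  qed
  moreover have "unit_word ` X \<subseteq> (words X :: ('i \<Rightarrow> 'f) set)"
    by (auto simp: unit_word_def words_def)
  ultimately show ?thesis
    using word_eq_sum_unit_words[OF assms] card_image[OF inj]
    by (intro fvec.dim_unique[of "unit_word ` X"]) auto
qed

lemma linear_code_basis:
  assumes "linear_code X C"
  obtains B where "finite B" "B \<subseteq> C" "fvec.independent B" "fvec.span B = C" "card B = fvec.dim C"
proof -
  obtain B where B: "B \<subseteq> C" "fvec.independent B" "C \<subseteq> fvec.span B" "card B = fvec.dim C"
    using fvec.basis_exists by blast
  have "fvec.span B = C"
    using B assms by (simp add: linear_code_def fvec.span_minimal subset_antisym)
  moreover have "finite B"
    using fvec.independent_span_bound[of "unit_word ` X" B] B assms
      word_eq_sum_unit_words[of X] by (auto simp: linear_code_def)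
  ultimately show ?thesis using B that by blast
qed

lemma gen_matrix_exists:
  assumes "linear_code X C"
  shows "\<exists>G. gen_matrix (fvec.dim C) G C"
proof -
  obtain B where B: "finite B" "fvec.independent B" "fvec.span B = C" "card B = fvec.dim C"
    using linear_code_basis[OF assms] by metis
  obtain G where "bij_betw G {..<fvec.dim C} B"
    using ex_bij_betw_nat_finite[OF B(1)] B(4) by (auto simp: lessThan_atLeast0)
  then show ?thesis
    using B by (auto simp: gen_matrix_def indep_family_def bij_betw_def)
qed

lemma dim_linear_image_le:
  fixes f :: "('i \<Rightarrow> 'f::field) \<Rightarrow> 'j \<Rightarrow> 'f"
  assumes "linear_code X C" and lin: "Vector_Spaces.linear fscale fscale f"
  shows "fvec.dim (f ` C) \<le> fvec.dim C"
proof -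
  obtain B where B: "finite B" "fvec.span B = C" "card B = fvec.dim C"
    using linear_code_basis[OF assms(1)] by metis
  have "fvec.dim (f ` C) \<le> card (f ` B)"
    using fvec_pair.linear_span_image[OF lin, of B] B by (intro fvec.dim_le_card) auto
  then show ?thesis using card_image_le[OF B(1), of f] B(3) by linarith
qed

lemma dim_subset:
  assumes "linear_code X D" "C \<subseteq> D"
  shows "fvec.dim C \<le> fvec.dim D"
proof -
  obtain B where B: "finite B" "fvec.span B = D" "card B = fvec.dim D"
    using linear_code_basis[OF assms(1)] by metis
  then show ?thesis using assms(2) fvec.dim_le_card[of C B] by auto
qed

lemma linear_code_words: "finite X \<Longrightarrow> linear_code X (words X)"
  by (simp add: linear_code_def subspace_words)

lemma linear_code_dim_le: "linear_code X C \<Longrightarrow> fvec.dim C \<le> card X"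
  using dim_subset[OF linear_code_words, of X C] dim_words[of X]
  by (metis linear_code_def)

lemma linear_code_puncture:
  assumes "linear_code X C" "finite S"
  shows "linear_code S (puncture C S)"
  using assms subspace_linear_image[OF linear_restr]
  by (auto simp: linear_code_def puncture_eq words_def restr_def)

lemma puncture_puncture: "puncture (puncture C S) T = puncture C (S \<inter> T)"
  by (auto simp: puncture_def image_image intro!: image_cong)

lemma puncture_id: "C \<subseteq> words X \<Longrightarrow> puncture C X = C"
  unfolding puncture_eq restr_def words_def by (rule trans[OF image_cong image_ident]) fastforce+


section \<open>Minimum weight\<close>

lemma min_weight_le: "c \<in> C \<Longrightarrow> c \<noteq> 0 \<Longrightarrow> min_weight w C \<le> w c"
  by (auto simp: min_weight_def intro!: cInf_lower)

lemma min_weight_ge: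
  "c0 \<in> C \<Longrightarrow> c0 \<noteq> 0 \<Longrightarrow> (\<And>c. c \<in> C \<Longrightarrow> c \<noteq> 0 \<Longrightarrow> k \<le> w c) \<Longrightarrow> k \<le> min_weight w C"
  unfolding min_weight_def by (auto intro!: cInf_greatest)

section \<open>Ranks of coordinate sets\<close>

text \<open>For a linear code this is the rank of the generator matrix columns at \<open>T\<close>,
  expressed without choosing a matrix.\<close>

definition code_rank :: "('i \<Rightarrow> 'f::field) set \<Rightarrow> 'i set \<Rightarrow> nat" where
  "code_rank C T = fvec.dim (puncture C T)"

text \<open>For a linear code, the values on \<open>J\<close> fix those on \<open>T\<close>, since
  codewords agreeing on \<open>J\<close> differ by one vanishing there. In matroid terms,
  \<open>T\<close> lies in the closure of \<open>J\<close>.\<close>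

definition determines :: "('i \<Rightarrow> 'f::field) set \<Rightarrow> 'i set \<Rightarrow> 'i set \<Rightarrow> bool" where
  "determines C J T \<longleftrightarrow> (\<forall>c\<in>C. (\<forall>i\<in>J. c i = 0) \<longrightarrow> (\<forall>i\<in>T. c i = 0))"

lemma inj_on_linear:
  fixes f :: "('i \<Rightarrow> 'f::field) \<Rightarrow> 'j \<Rightarrow> 'f"
  assumes "Vector_Spaces.linear fscale fscale f" "fvec.subspace C"
    "\<And>c. c \<in> C \<Longrightarrow> f c = 0 \<Longrightarrow> c = 0"
  shows "inj_on f C"
proof (rule inj_onI)
  fix x y assume xy: "x \<in> C" "y \<in> C" "f x = f y"
  then have "f (x - y) = 0"
    using fvec_pair.linear_diff[OF assms(1), of x y] by simp
  moreover have "x - y \<in> C" using xy assms(2) by (simp add: fvec.subspace_diff)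
  ultimately show "x = y" using assms(3) by force
qed

text \<open>Determination makes the restriction from \<open>T\<close> to \<open>J\<close> injective
  on the punctured code, so no dimension is lost.\<close>

lemma code_rank_determines:
  fixes C :: "('i \<Rightarrow> 'f::field) set"
  assumes C: "linear_code X C" and T: "finite T" and J: "J \<subseteq> T" "determines C J T"
  shows "code_rank C J = code_rank C T"
proof -
  have "inj_on (restr J) (puncture C T)"
  proof (rule inj_on_linear[OF linear_restr])
    show "fvec.subspace (puncture C T)"
      using linear_code_puncture[OF C T] by (simp add: linear_code_def)
    fix c assume "c \<in> puncture C T" "restr J c = 0"
    then show "c = 0"
      using J by (fastforce simp: puncture_def restr_def determines_def fun_eq_iff split: if_splits)
  qed
  then have "fvec.dim (restr J ` puncture C T) = fvec.dim (puncture C T)"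
    using linear_code_puncture[OF C T]
    by (intro dim_linear_inj_image linear_restr) (auto simp: linear_code_def)
  moreover have "restr J ` puncture C T = puncture C J"
    using J puncture_puncture[of C T J] by (simp add: puncture_eq Int_absorb1)
  ultimately show ?thesis by (simp add: code_rank_def)
qed

lemma code_rank_mono:
  assumes "linear_code X C" "finite T" "S \<subseteq> T"
  shows "code_rank C S \<le> code_rank C T"
  using dim_linear_image_le[OF linear_code_puncture[OF assms(1,2)] linear_restr, of S]
    puncture_puncture[of C T S] assms(3)
  by (simp add: code_rank_def puncture_eq Int_absorb1)

lemma code_rank_le_card:
  assumes "linear_code X C" "finite T"
  shows "code_rank C T \<le> card T"
  using linear_code_dim_le[OF linear_code_puncture[OF assms]] by (simp add: code_rank_def)

lemma code_rank_full:
  assumes "linear_code X C"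
  shows "code_rank C X = fvec.dim C"
  using assms by (simp add: code_rank_def linear_code_def puncture_id)

text \<open>A minimal determining subset of \<open>T\<close> is an information set.\<close>

lemma information_set:
  fixes C :: "('i \<Rightarrow> 'f::field) set"
  assumes C: "linear_code X C" and T: "finite T"
  obtains J where "J \<subseteq> T" "determines C J T" "words J \<subseteq> puncture C J" "card J = code_rank C T"
proof -
  have "\<exists>J. (J \<subseteq> T \<and> determines C J T) \<and>
      (\<forall>J'. J' \<subseteq> T \<and> determines C J' T \<longrightarrow> card J \<le> card J')"
    by (rule ex_has_least_nat[of "\<lambda>J. J \<subseteq> T \<and> determines C J T" T]) (auto simp: determines_def)
  then obtain J where J: "J \<subseteq> T" "determines C J T"
    and least: "\<And>J'. J' \<subseteq> T \<Longrightarrow> determines C J' T \<Longrightarrow> card J \<le> card J'"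
    by blast
  have fin: "finite J" using J T finite_subset by blast
  have sub: "fvec.subspace (puncture C J)"
    using linear_code_puncture[OF C fin] by (simp add: linear_code_def)
  have full: "words J \<subseteq> puncture C J"
  proof (rule words_subset_if_unit_words[OF fin sub])
    fix x assume x: "x \<in> J"
    \<comment> \<open>By minimality some codeword vanishes on \<open>J - {x}\<close> but not on
      \<open>T\<close>. It cannot vanish at \<open>x\<close> too, so scaling it gives the unit
      word.\<close>
    have "\<not> determines C (J - {x}) T"
    proof
      assume "determines C (J - {x}) T"
      then have "card J \<le> card (J - {x})" using least J by blast
      then show False using card_Diff1_less[OF fin x] by linarith
    qed
    then obtain c where c: "c \<in> C" "\<forall>i\<in>J - {x}. c i = 0" "\<not> (\<forall>i\<in>T. c i = 0)"
      by (auto simp: determines_def)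
    have cx: "c x \<noteq> 0" using c J(2) by (auto simp: determines_def)
    have "unit_word x = fscale (inverse (c x)) (restr J c)"
      using c(2) cx x by (auto simp: unit_word_def fscale_def restr_def fun_eq_iff)
    moreover have "restr J c \<in> puncture C J" using c by (simp add: puncture_eq)
    ultimately show "unit_word x \<in> puncture C J" using sub by (simp add: fvec.subspace_scale)
  qed
  moreover have "puncture C J \<subseteq> words J" by (auto simp: puncture_def words_def)
  ultimately have "puncture C J = words J" by blast
  then have "card J = code_rank C J" by (simp add: code_rank_def dim_words fin)
  also have "\<dots> = code_rank C T" using code_rank_determines[OF C T J] .
  finally show ?thesis using J full that by blast
qed

text \<open>Information sets of \<open>S\<close> and \<open>T\<close> together determine the union,
  so their joint size bounds its rank.\<close>

lemma code_rank_Un_le: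
  assumes C: "linear_code X C" and fin: "finite S" "finite T"
  shows "code_rank C (S \<union> T) \<le> code_rank C S + code_rank C T"
proof -
  obtain I where I: "I \<subseteq> S" "determines C I S" "card I = code_rank C S"
    using information_set[OF C fin(1)] by metis
  obtain J where J: "J \<subseteq> T" "determines C J T" "card J = code_rank C T"
    using information_set[OF C fin(2)] by metis
  have "code_rank C (I \<union> J) = code_rank C (S \<union> T)"
    using I J fin by (intro code_rank_determines[OF C]) (auto simp: determines_def)
  moreover have "code_rank C (I \<union> J) \<le> card (I \<union> J)"
    using I J fin by (intro code_rank_le_card[OF C]) (auto intro: finite_subset)
  ultimately show ?thesis using card_Un_le[of I J] I J by linarith
qed

lemma code_rank_le_add_card:
  assumes C: "linear_code X C" and T: "finite T" and "S \<subseteq> T"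
  shows "code_rank C T \<le> code_rank C S + card (T - S)"
proof -
  have "code_rank C T \<le> code_rank C S + code_rank C (T - S)"
    using code_rank_Un_le[OF C, of S "T - S"] assms(2,3)
    by (metis Diff_partition finite_Diff finite_subset)
  then show ?thesis using code_rank_le_card[OF C, of "T - S"] T by fastforce
qed

lemma nonzero_word_vanishing:
  assumes C: "linear_code X C" and T: "finite T" "code_rank C T < fvec.dim C"
  obtains c where "c \<in> C" "c \<noteq> 0" "\<And>i. i \<in> T \<Longrightarrow> c i = 0"
proof -
  \<comment> \<open>\<open>T\<close> may stick out of \<open>X\<close>, hence the comparison with
    the union.\<close>
  have fin: "finite (X \<union> T)" using C T by (simp add: linear_code_def)
  have "\<not> determines C T (X \<union> T)"
    using code_rank_determines[OF C fin, of T] code_rank_mono[OF C fin, of X] T(2)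
      code_rank_full[OF C] by fastforce
  then show ?thesis using that by (fastforce simp: determines_def)
qed

text \<open>Converse of \<open>code_rank_determines\<close>. A codeword vanishing on
  \<open>S\<close> but not at some \<open>x\<close> in \<open>T\<close> would allow \<open>x\<close>
  to be adjoined to an information set of \<open>S\<close>, giving more independent coordinates in
  \<open>T\<close> than its rank.\<close>

lemma determines_if_code_rank_eq:
  fixes C :: "('i \<Rightarrow> 'f::field) set"
  assumes C: "linear_code X C" and T: "finite T" "S \<subseteq> T" and rk: "code_rank C S = code_rank C T"
  shows "determines C S T"
proof (rule ccontr)
  assume "\<not> determines C S T"
  then obtain c x where c: "c \<in> C" "\<forall>i\<in>S. c i = 0" and x: "x \<in> T" "c x \<noteq> 0"
    by (auto simp: determines_def)
  obtain J where J: "J \<subseteq> S" "words J \<subseteq> puncture C J" "card J = code_rank C S"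
    using information_set[OF C finite_subset[OF T(2,1)]] by metis
  have xJ: "x \<notin> J" using c x J by auto
  have fin: "finite (insert x J)" using J T by (auto intro: finite_subset)
  have sub: "fvec.subspace (puncture C (insert x J))"
    using linear_code_puncture[OF C fin] by (simp add: linear_code_def)
  have cJ: "fscale (inverse (c x)) (restr (insert x J) c) = unit_word x"
    using c J(1) x by (auto simp: fscale_def restr_def unit_word_def fun_eq_iff)
  have ux: "unit_word x \<in> puncture C (insert x J)"
    using c(1) fvec.subspace_scale[OF sub, of "restr (insert x J) c" "inverse (c x)"] cJ
    by (simp add: puncture_eq)
  have "words (insert x J) \<subseteq> puncture C (insert x J)"
  proof (rule words_subset_if_unit_words[OF fin sub])
    fix y assume "y \<in> insert x J"
    then consider "y = x" | "y \<in> J" "y \<noteq> x" using xJ by auto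
    then show "unit_word y \<in> puncture C (insert x J)"
    proof cases
      case 2
      have "unit_word y \<in> words J" using 2 by (auto simp: unit_word_def words_def)
      then obtain b where b: "b \<in> C" "unit_word y = restr J b"
        using J(2) by (auto simp: puncture_eq)
      \<comment> \<open>Subtracting a multiple of the unit word at \<open>x\<close> clears the
        uncontrolled value of \<open>b\<close> there.\<close>
      have "unit_word y = restr (insert x J) b - fscale (b x) (unit_word x)"
        using b(2) xJ 2 by (auto simp: unit_word_def restr_def fscale_def fun_eq_iff split: if_splits)
      then show ?thesis
        using fvec.subspace_diff[OF sub _ fvec.subspace_scale[OF sub ux]] b(1)
        by (metis imageI puncture_eq)
    qed (use ux in simp)
  qed
  moreover have "puncture C (insert x J) \<subseteq> words (insert x J)"
    by (auto simp: puncture_def words_def)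
  ultimately have "code_rank C (insert x J) = card (insert x J)"
    by (metis code_rank_def dim_words fin subset_antisym)
  also have "\<dots> = Suc (code_rank C T)" using xJ J fin rk by simp
  finally show False
    using code_rank_mono[OF C T(1), of "insert x J"] J(1) T(2) x(1) by auto
qed


section \<open>Minimum distance and rank\<close>

text \<open>Some nonzero codeword vanishes on \<open>T\<close>, so its support lies in
  \<open>X - T\<close>. Contrapositively, more than \<open>card X - dmin C\<close> coordinates have
  full rank.\<close>

lemma card_add_dmin_le:
  assumes C: "linear_code X C" and T: "T \<subseteq> X" "code_rank C T < fvec.dim C"
  shows "card T + dmin C \<le> card X"
proof -
  have X: "finite X" using C by (simp add: linear_code_def)
  then have "finite T" using T finite_subset by blast
  then obtain c where c: "c \<in> C" "c \<noteq> 0" "\<And>i. i \<in> T \<Longrightarrow> c i = 0"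
    using nonzero_word_vanishing[OF C _ T(2)] by metis
  have "dmin C \<le> card {i. c i \<noteq> 0}"
    unfolding dmin_def using c by (rule_tac min_weight_le)
  also have "\<dots> \<le> card (X - T)"
    using c C X by (intro card_mono) (auto simp: linear_code_def words_def)
  also have "\<dots> = card X - card T" using T(1) \<open>finite T\<close> by (simp add: card_Diff_subset)
  finally show ?thesis using card_mono[OF X T(1)] by linarith
qed

text \<open>A set of \<open>fvec.dim C - 1\<close> coordinates cannot have full rank.\<close>

lemma singleton_bound:
  assumes C: "linear_code X C" and k: "1 \<le> fvec.dim C"
  shows "fvec.dim C + dmin C \<le> card X + 1"
proof -
  have X: "finite X" using C by (simp add: linear_code_def)
  obtain T where T: "T \<subseteq> X" "card T = fvec.dim C - 1" "finite T"
    using obtain_subset_with_card_n[of "fvec.dim C - 1" X] linear_code_dim_le[OF C]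
    by (metis diff_le_self le_trans)
  then show ?thesis
    using card_add_dmin_le[OF C T(1)] code_rank_le_card[OF C T(3)] k by linarith
qed

lemma nonzero_word_if_dim_pos:
  assumes "0 < fvec.dim C"
  shows "\<exists>c\<in>C. c \<noteq> 0"
proof (rule ccontr)
  assume "\<not> ?thesis"
  then have "C \<subseteq> fvec.span {}" by auto
  then show False using fvec.dim_le_card[of C "{}"] assms by simp
qed

text \<open>The Singleton bound turns the lower bound on the distance into an equality.\<close>

lemma mds_code_punctureI:
  assumes C: "linear_code X C" and S: "finite S" "code_rank C S = k" "1 \<le> k"
    and d: "card S - k + 1 \<le> dmin (puncture C S)"
  shows "mds_code S k (puncture C S)"
  using linear_code_puncture[OF C S(1)] singleton_bound[of S "puncture C S"] S d
    linear_code_dim_le[of S "puncture C S"]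
  by (auto simp: mds_code_def code_rank_def)

text \<open>Erasure correction: a word of the punctured code supported on \<open>D\<close> is too
  light to be nonzero.\<close>

lemma determines_delete:
  assumes S: "finite S" "D \<subseteq> S" "card D < dmin (puncture C S)"
  shows "determines C (S - D) S"
  unfolding determines_def
proof (intro ballI impI, rule ccontr)
  fix c i assume c: "c \<in> C" "\<forall>i\<in>S - D. c i = 0" and i: "i \<in> S" "c i \<noteq> 0"
  have "restr S c \<in> puncture C S" "restr S c \<noteq> 0"
    using c i by (auto simp: puncture_eq restr_def fun_eq_iff)
  then have "dmin (puncture C S) \<le> card {i. restr S c i \<noteq> 0}"
    unfolding dmin_def by (rule min_weight_le)
  also have "\<dots> \<le> card D"
    using c S by (intro card_mono) (auto simp: restr_def intro: finite_subset split: if_splits)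
  finally show False using S(3) by simp
qed

text \<open>With fewer than \<open>\<delta>\<close> new coordinates, the old part of
  \<open>S\<close> would determine \<open>S\<close> and the rank could not grow. Otherwise
  \<open>\<delta> - 1\<close> new coordinates can be erased without loss of rank, and each remaining
  one adds at most 1.\<close>

lemma code_rank_increment:
  assumes C: "linear_code X C" and fin: "finite U" "finite S"
    and \<delta>: "1 \<le> \<delta>" "\<delta> \<le> dmin (puncture C S)"
    and inc: "code_rank C U < code_rank C (U \<union> S)"
  shows "code_rank C (U \<union> S) + (\<delta> - 1) \<le> code_rank C U + card (S - U)"
proof -
  have "\<delta> \<le> card (S - U)"
  proof (rule ccontr)
    assume "\<not> \<delta> \<le> card (S - U)"
    then have "determines C (S - (S - U)) S"
      using \<delta> fin by (intro determines_delete) auto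
    then have det: "determines C U (U \<union> S)" by (auto simp: determines_def)
    show False using code_rank_determines[OF C _ _ det] fin inc by auto
  qed
  then obtain D where D: "D \<subseteq> S - U" "card D = \<delta> - 1" "finite D"
    using obtain_subset_with_card_n[of "\<delta> - 1" "S - U"] by (metis diff_le_self le_trans)
  have "determines C (S - D) S"
    using D \<delta> fin by (intro determines_delete) auto
  then have "determines C (U \<union> (S - D)) (U \<union> S)" by (auto simp: determines_def)
  then have "code_rank C (U \<union> S) = code_rank C (U \<union> (S - D))"
    using code_rank_determines[OF C] fin by (metis Diff_subset Un_mono finite_UnI subset_refl)
  also have "\<dots> \<le> code_rank C U + card ((U \<union> (S - D)) - U)"
    using fin by (intro code_rank_le_add_card[OF C]) auto
  also have "(U \<union> (S - D)) - U = (S - U) - D" by blast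
  also have "card \<dots> = card (S - U) - (\<delta> - 1)" using D by (simp add: card_Diff_subset)
  finally show ?thesis using \<open>\<delta> \<le> card (S - U)\<close> by linarith
qed


section \<open>Optimal locally repairable codes\<close>

text \<open>Here \<open>k\<close> and \<open>\<delta>\<close> stand for the scalar parameters
  \<open>K\<^sub>L\<close> and \<open>\<Delta>\<^sub>L\<close>. \<open>optimal\<close> is the
  distance formula with its ceiling evaluated to \<open>l\<close> and the subtracted terms moved
  across, so that it can be stated in the naturals.\<close>

locale optimal_lrc =
  fixes A :: "('i \<Rightarrow> 'f::field) set" and X :: "'i set" and \<S> :: "'i set set" and l k \<delta> :: nat
  assumes code: "linear_code X A"
    and dim_A: "fvec.dim A = l * k"
    and pos: "1 \<le> l" "1 \<le> k" "1 \<le> \<delta>"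
    and optimal: "card X + 1 = dmin A + l * k + (l - 1) * (\<delta> - 1)"
    and cover: "\<Union>\<S> = X"
    and card_local: "S \<in> \<S> \<Longrightarrow> card S \<le> k + \<delta> - 1"
    and dmin_local: "S \<in> \<S> \<Longrightarrow> \<delta> \<le> dmin (puncture A S)"
begin

section \<open>Ranks and sizes of local sets\<close>

lemma finite_X: "finite X"
  using code by (simp add: linear_code_def)

lemma local_subset: "S \<in> \<S> \<Longrightarrow> S \<subseteq> X"
  using cover by blast

lemma finite_local: "S \<in> \<S> \<Longrightarrow> finite S"
  using local_subset finite_X finite_subset by blast

lemma rank_empty: "code_rank A {} = 0"
  using code_rank_le_card[OF code, of "{}"] by simp

text \<open>A zero restriction would have \<open>dmin\<close> 0 by convention, below
  \<open>\<delta>\<close>.\<close>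

lemma rank_local_pos:
  assumes "S \<in> \<S>"
  shows "0 < code_rank A S"
proof (rule ccontr)
  assume "\<not> 0 < code_rank A S"
  then have "determines A {} S"
    using determines_if_code_rank_eq[OF code finite_local[OF assms], of "{}"] rank_empty by simp
  then have "puncture A S \<subseteq> {0}" by (auto simp: determines_def puncture_def fun_eq_iff)
  then show False using dmin_local[OF assms] pos by (simp add: dmin_def min_weight_def)
qed

lemma rank_local_add_le_card:
  assumes "S \<in> \<S>"
  shows "code_rank A S + (\<delta> - 1) \<le> card S"
  using code_rank_increment[OF code _ finite_local[OF assms] pos(3) dmin_local[OF assms], of "{}"]
    rank_local_pos[OF assms] rank_empty by simp

lemma rank_local_le: "S \<in> \<S> \<Longrightarrow> code_rank A S \<le> k"
  using rank_local_add_le_card card_local pos by fastforce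

lemma card_le_if_rank_less:
  "T \<subseteq> X \<Longrightarrow> code_rank A T < l * k \<Longrightarrow> card T \<le> (l * k - 1) + (l - 1) * (\<delta> - 1)"
  using card_add_dmin_le[OF code, of T] dim_A optimal by simp

text \<open>Otherwise \<open>U\<close> would determine every local set, hence all of
  \<open>X\<close>.\<close>

lemma local_increasing_rank:
  assumes U: "U \<subseteq> X" "code_rank A U < l * k"
  shows "\<exists>S\<in>\<S>. code_rank A U < code_rank A (U \<union> S)"
proof (rule ccontr)
  assume no: "\<not> ?thesis"
  have U_fin: "finite U" using U finite_X finite_subset by blast
  have "determines A U S" if "S \<in> \<S>" for S
  proof -
    have fin: "finite (U \<union> S)" using U_fin finite_local[OF that] by simp
    have "code_rank A U = code_rank A (U \<union> S)"
      using no that code_rank_mono[OF code fin, of U] by force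
    then have "determines A U (U \<union> S)"
      by (intro determines_if_code_rank_eq[OF code fin]) auto
    then show ?thesis by (auto simp: determines_def)
  qed
  then have "determines A U X"
    using cover by (auto simp: determines_def)
  then show False
    using code_rank_determines[OF code finite_X U(1)] code_rank_full[OF code] dim_A U(2) by simp
qed

text \<open>Enlarge \<open>U\<close> to a maximal set below full rank. Its rank is
  \<open>l * k - 1\<close>, as one more coordinate adds at most 1, and optimality bounds its size.
  The enlargement adds at least as many coordinates as rank.\<close>

lemma card_le_rank_add:
  assumes U: "U \<subseteq> X" "code_rank A U < l * k"
  shows "card U \<le> code_rank A U + (l - 1) * (\<delta> - 1)"
proof -
  define \<T> where "\<T> = {T. U \<subseteq> T \<and> T \<subseteq> X \<and> code_rank A T < l * k}"
  have "finite \<T>" using finite_X by (auto simp: \<T>_def intro: finite_subset[of _ "Pow X"])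
  moreover have "U \<in> \<T>" using U by (simp add: \<T>_def)
  ultimately obtain T where T: "T \<in> \<T>" and max: "\<And>T'. T' \<in> \<T> \<Longrightarrow> T \<subseteq> T' \<Longrightarrow> T' = T"
    using finite_has_maximal2 by metis
  have sub: "U \<subseteq> T" "T \<subseteq> X" and rk: "code_rank A T < l * k" using T by (auto simp: \<T>_def)
  have fin: "finite T" using sub finite_X finite_subset by blast
  have "T \<noteq> X" using rk code_rank_full[OF code] dim_A by auto
  then obtain x where x: "x \<in> X" "x \<notin> T" using sub by blast
  have "insert x T \<notin> \<T>" using max[of "insert x T"] x by blast
  then have "l * k \<le> code_rank A (insert x T)" using sub x by (auto simp: \<T>_def)
  also have "\<dots> \<le> code_rank A T + 1"
    using code_rank_le_add_card[OF code, of "insert x T" T] fin x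
    by (simp add: insert_Diff_if subset_insertI)
  finally have "l * k - 1 \<le> code_rank A T" by simp
  moreover have "code_rank A T \<le> code_rank A U + card (T - U)"
    by (rule code_rank_le_add_card[OF code fin sub(1)])
  moreover have "card T = card U + card (T - U)"
    using fin sub by (metis card_Un_disjoint Diff_disjoint Diff_partition finite_Diff finite_subset)
  ultimately show ?thesis using card_le_if_rank_less[OF sub(2) rk] by linarith
qed

text \<open>
  Each local set that raises the rank of \<open>U\<close> raises \<open>card U - rank U\<close> by at least \<open>\<delta> - 1\<close>,
  and as each step gains rank at most \<open>k\<close>, at least \<open>p\<close> further steps fit below full rank.
\<close>

lemma greedy_bound:
  assumes "U \<subseteq> X" "code_rank A U + p * k < l * k"
  shows "card U + p * (\<delta> - 1) \<le> code_rank A U + (l - 1) * (\<delta> - 1)"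
  using assms
proof (induction p arbitrary: U)
  case 0
  then show ?case using card_le_rank_add by simp
next
  case (Suc p)
  obtain S where S: "S \<in> \<S>" "code_rank A U < code_rank A (U \<union> S)"
    using local_increasing_rank[OF Suc.prems(1)] Suc.prems(2) by auto
  have U_fin: "finite U" using Suc.prems finite_X finite_subset by blast
  have "code_rank A (U \<union> S) \<le> code_rank A U + k"
    using code_rank_Un_le[OF code U_fin finite_local[OF S(1)]] rank_local_le[OF S(1)] by linarith
  then have "card (U \<union> S) + p * (\<delta> - 1) \<le> code_rank A (U \<union> S) + (l - 1) * (\<delta> - 1)"
    using Suc.prems local_subset[OF S(1)] by (intro Suc.IH) auto
  moreover have "code_rank A (U \<union> S) + (\<delta> - 1) \<le> code_rank A U + card (S - U)"
    by (rule code_rank_increment[OF code U_fin finite_local[OF S(1)] pos(3) dmin_local[OF S(1)] S(2)])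
  moreover have "card (U \<union> S) = card U + card (S - U)"
    using U_fin finite_local[OF S(1)]
    by (metis Diff_disjoint Un_Diff_cancel card_Un_disjoint finite_Diff)
  ultimately show ?case by simp
qed

context
  assumes \<delta>_ge_2: "2 \<le> \<delta>"
begin

text \<open>A smaller rank would leave room for all \<open>l - 1\<close> further greedy steps, and
  the bound would then leave no redundancy in \<open>S\<close>.\<close>

lemma rank_local:
  assumes "S \<in> \<S>"
  shows "code_rank A S = k"
proof (rule ccontr)
  assume "code_rank A S \<noteq> k"
  then have "code_rank A S < k" using rank_local_le[OF assms] by simp
  then have "code_rank A S + (l - 1) * k < l * k" using pos by (cases l) auto
  then have "card S \<le> code_rank A S"
    using greedy_bound[OF local_subset[OF assms]] by fastforce
  then show False using rank_local_add_le_card[OF assms] \<delta>_ge_2 by simp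
qed

lemma card_local_eq: "S \<in> \<S> \<Longrightarrow> card S = k + \<delta> - 1"
  using rank_local_add_le_card rank_local card_local pos by fastforce

lemma mds_local:
  assumes "S \<in> \<S>"
  shows "mds_code S k (puncture A S)"
  using mds_code_punctureI[OF code finite_local[OF assms] rank_local[OF assms] pos(2)]
    card_local_eq[OF assms] dmin_local[OF assms] pos by simp

text \<open>Two overlapping local sets have joint rank below \<open>2 * k\<close>, so
  \<open>l - 2\<close> greedy steps still fit and the size of the union exceeds its rank by at most
  \<open>\<delta> - 1\<close>. But \<open>S\<close> alone has this excess, and \<open>T\<close>
  increases it, whether or not it raises the rank.\<close>

lemma local_disjoint:
  assumes l: "2 \<le> l" and ST: "S \<in> \<S>" "T \<in> \<S>" "S \<noteq> T"
  shows "S \<inter> T = {}"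
proof (rule ccontr)
  assume meet: "S \<inter> T \<noteq> {}"
  note fin = finite_local[OF ST(1)] finite_local[OF ST(2)]
  note cards = card_local_eq[OF ST(1)] card_local_eq[OF ST(2)]
  have "\<not> T \<subseteq> S" using card_subset_eq[OF fin(1), of T] cards ST(3) by auto
  then have diff_pos: "0 < card (T - S)" using fin by (simp add: card_gt_0_iff)
  have "card (T - S) < card T" using meet fin by (intro psubset_card_mono) auto
  then have diff_less: "card (T - S) < k + \<delta> - 1" using cards by simp
  have Un: "card (S \<union> T) = card S + card (T - S)"
    using fin by (metis Diff_disjoint Un_Diff_cancel card_Un_disjoint finite_Diff)
  have inc: "code_rank A (S \<union> T) + (\<delta> - 1) \<le> k + card (T - S)" if "k < code_rank A (S \<union> T)"
    using code_rank_increment[OF code fin pos(3) dmin_local[OF ST(2)]] that rank_local[OF ST(1)]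
    by simp
  have ge: "k \<le> code_rank A (S \<union> T)"
    using code_rank_mono[OF code, of "S \<union> T" S] fin rank_local[OF ST(1)] by simp
  have "code_rank A (S \<union> T) < 2 * k"
    using inc diff_less pos by (cases "k < code_rank A (S \<union> T)") auto
  moreover have "2 * k + (l - 2) * k = l * k"
    using l by (auto simp: le_iff_add algebra_simps)
  ultimately have "code_rank A (S \<union> T) + (l - 2) * k < l * k" by linarith
  then have "card (S \<union> T) + (l - 2) * (\<delta> - 1) \<le> code_rank A (S \<union> T) + (l - 1) * (\<delta> - 1)"
    using greedy_bound local_subset ST by simp
  moreover have "(l - 1) * (\<delta> - 1) = (l - 2) * (\<delta> - 1) + (\<delta> - 1)"
    using l by (auto simp: numeral_2_eq_2 le_iff_add)
  ultimately have "card (S \<union> T) \<le> code_rank A (S \<union> T) + (\<delta> - 1)" by linarith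
  then show False
    using Un cards inc ge diff_pos \<delta>_ge_2 pos by (cases "k < code_rank A (S \<union> T)") auto
qed

end

text \<open>Disjoint local sets of equal size covering \<open>X\<close> must number exactly
  \<open>m\<close>, so they can serve as the blocks themselves.\<close>

lemma mds_decomposition_disjoint:
  assumes \<delta>: "2 \<le> \<delta>" and l: "2 \<le> l" and X: "card X = m * (k + \<delta> - 1)"
  shows "\<exists>P. mds_decomposition m (k + \<delta> - 1) k \<delta> X A P"
proof -
  have fin: "finite \<S>" using cover finite_X by (simp add: finite_UnionD)
  have "card (\<Union>\<S>) = (\<Sum>S\<in>\<S>. card S)"
    using local_disjoint[OF \<delta> l] finite_local
    by (intro card_Union_disjoint) (auto simp: pairwise_def disjnt_def)
  also have "\<dots> = card \<S> * (k + \<delta> - 1)"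
    using card_local_eq[OF \<delta>] by simp
  finally have "card \<S> = m" using X cover pos by simp
  then obtain P where P: "bij_betw P {..<m} \<S>"
    using ex_bij_betw_nat_finite[OF fin] by (auto simp: lessThan_atLeast0)
  then have PS: "P i \<in> \<S>" if "i < m" for i using that by (auto simp: bij_betw_def)
  have "(\<Union>i<m. P i) = X" using P cover by (auto simp: bij_betw_def)
  moreover have "disjoint_family_on P {..<m}"
    unfolding disjoint_family_on_def
  proof (intro ballI impI)
    fix i j assume ij: "i \<in> {..<m}" "j \<in> {..<m}" "i \<noteq> j"
    then have "P i \<noteq> P j" using P by (auto simp: bij_betw_def inj_on_def)
    then show "P i \<inter> P j = {}" using ij PS by (intro local_disjoint[OF \<delta> l]) auto
  qed
  moreover have "card (P i) = k + \<delta> - 1 \<and> mds_code (P i) k (puncture A (P i)) \<and>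
      dmin (puncture A (P i)) = \<delta>" if "i < m" for i
    using card_local_eq[OF \<delta> PS[OF that]] mds_local[OF \<delta> PS[OF that]] pos
    by (auto simp: mds_code_def)
  ultimately show ?thesis by (auto simp: mds_decomposition_def)
qed

text \<open>
  If \<open>l = 1\<close> or \<open>\<delta> = 1\<close>, optimality is the Singleton bound with equality: the code is MDS,
  its local sets may overlap, but every partition into sets of the right size will do.
\<close>

lemma mds_decomposition_arbitrary:
  assumes cases: "\<delta> = 1 \<or> l = 1" and P: "(\<Union>i<m. P i) = X" "disjoint_family_on P {..<m}"
    "\<And>i. i < m \<Longrightarrow> card (P i) = k + \<delta> - 1"
    and l: "l \<le> m"
  shows "mds_decomposition m (k + \<delta> - 1) k \<delta> X A P"
proof -
  \<comment> \<open>In both cases the term \<open>(l - 1) * (\<delta> - 1)\<close> vanishes, so any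
    \<open>l * k\<close> coordinates have full rank.\<close>
  have full: "l * k \<le> code_rank A T" if "T \<subseteq> X" "l * k \<le> card T" for T
    using card_le_if_rank_less[OF that(1)] that(2) cases pos by (cases "code_rank A T < l * k") auto
  have local: "mds_code (P i) k (puncture A (P i)) \<and> dmin (puncture A (P i)) = \<delta>"
    if i: "i < m" for i
  proof -
    have sub: "P i \<subseteq> X" using P i by blast
    have fin: "finite (P i)" using sub finite_X finite_subset by blast
    have rank: "code_rank A (P i) = k"
      using cases
    proof
      assume "l = 1"
      then show ?thesis
        using full[OF sub] P(3)[OF i] code_rank_mono[OF code finite_X sub] code_rank_full[OF code]
          dim_A pos by simp
    next
      assume "\<delta> = 1"
      have "card (P i) \<le> l * k" using P(3)[OF i] pos \<open>\<delta> = 1\<close> by simp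
      \<comment> \<open>Extending the block to a set of full rank costs \<open>l * k - k\<close>
        coordinates, each worth at most 1, so the block itself accounts for rank
        \<open>k\<close>.\<close>
      then obtain T where T: "P i \<subseteq> T" "T \<subseteq> X" "card T = l * k"
        using exists_subset_between[of "P i" "l * k" X] finite_X sub linear_code_dim_le[OF code] dim_A
        by auto
      have "finite T" using T finite_X finite_subset by blast
      then have "l * k \<le> code_rank A (P i) + (l * k - k)"
        using code_rank_le_add_card[OF code _ T(1)] full[OF T(2)] T fin P(3)[OF i] \<open>\<delta> = 1\<close>
        by (simp add: card_Diff_subset)
      moreover have "k \<le> l * k" using pos by simp
      moreover have "code_rank A (P i) \<le> k"
        using code_rank_le_card[OF code fin] P(3)[OF i] \<open>\<delta> = 1\<close> by simp
      ultimately show ?thesis by linarith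
    qed
    obtain c0 where "c0 \<in> puncture A (P i)" "c0 \<noteq> 0"
      using nonzero_word_if_dim_pos[of "puncture A (P i)"] rank pos by (auto simp: code_rank_def)
    have "\<delta> \<le> dmin (puncture A (P i))"
      unfolding dmin_def
    proof (rule min_weight_ge)
      show "c0 \<in> puncture A (P i)" "c0 \<noteq> 0" by fact+
    next
      fix c assume c: "c \<in> puncture A (P i)" "c \<noteq> 0"
      have supp: "{x. c x \<noteq> 0} \<subseteq> P i" using c by (auto simp: puncture_def split: if_splits)
      have fin_supp: "finite {x. c x \<noteq> 0}" using supp fin finite_subset by blast
      show "\<delta> \<le> card {x. c x \<noteq> 0}"
        using cases
      proof
        assume "\<delta> = 1"
        moreover have "{x. c x \<noteq> 0} \<noteq> {}" using c by (auto simp: fun_eq_iff)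
        ultimately show ?thesis using fin_supp by (simp add: Suc_le_eq card_gt_0_iff)
      next
        assume "l = 1"
        show ?thesis
        proof (rule ccontr)
          assume "\<not> \<delta> \<le> card {x. c x \<noteq> 0}"
          \<comment> \<open>A word of weight below \<open>\<delta>\<close> has at least
            \<open>k\<close> zeros in the block. These determine the block, so the word is
            zero.\<close>
          then have "k \<le> card (P i - {x. c x \<noteq> 0})"
            using P(3)[OF i] supp fin_supp by (simp add: card_Diff_subset)
          then have "k \<le> code_rank A (P i - {x. c x \<noteq> 0})"
            using full[of "P i - {x. c x \<noteq> 0}"] sub \<open>l = 1\<close> by force
          moreover have "code_rank A (P i - {x. c x \<noteq> 0}) \<le> code_rank A (P i)"
            by (rule code_rank_mono[OF code fin]) blast
          ultimately have "code_rank A (P i - {x. c x \<noteq> 0}) = code_rank A (P i)"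
            using rank by simp
          then have det: "determines A (P i - {x. c x \<noteq> 0}) (P i)"
            by (intro determines_if_code_rank_eq[OF code fin]) auto
          obtain a where a: "a \<in> A" "c = restr (P i) a" using c(1) by (auto simp: puncture_eq)
          have ca: "c x = a x" if "x \<in> P i" for x
            using a(2) that by (simp add: restr_def)
          then have "\<forall>x\<in>P i - {x. c x \<noteq> 0}. a x = 0" by fastforce
          then have "\<forall>x\<in>P i. a x = 0"
            using det a(1) unfolding determines_def by blast
          then have "\<forall>x\<in>P i. c x = 0" using ca by simp
          then show False using c(2) supp by (auto simp: fun_eq_iff)
        qed
      qed
    qed
    then show ?thesis
      using mds_code_punctureI[OF code fin rank pos(2)] P(3)[OF i] pos by (auto simp: mds_code_def)
  qed
  then show ?thesis using P by (simp add: mds_decomposition_def)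
qed

end


section \<open>Codes on the edges of complete graphs\<close>

text \<open>Pairs inside the first part, inside the second part, and across.\<close>

lemma choose_2_add: "(a + b) choose 2 = (a choose 2) + (b choose 2) + a * b"
  by (induction b) (auto simp: numeral_2_eq_2)

text \<open>Convexity: the sum is largest when as many of the \<open>w i\<close> as possible are equal to \<open>n\<close>.\<close>

lemma sum_choose_2_le:
  fixes w :: "nat \<Rightarrow> nat"
  assumes "\<And>i. i < m \<Longrightarrow> w i \<le> n" "(\<Sum>i<m. w i) \<le> q * n + t" "t \<le> n"
  shows "(\<Sum>i<m. w i choose 2) \<le> q * (n choose 2) + (t choose 2)"
  using assms
proof (induction m arbitrary: q t)
  case (Suc m)
  show ?case
  proof (cases "w m \<le> t")
    case True
    then obtain u where u: "t = w m + u" using le_Suc_ex by blast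
    have "(\<Sum>i<m. w i choose 2) \<le> q * (n choose 2) + (u choose 2)"
      using Suc.prems u by (intro Suc.IH) auto
    then show ?thesis using choose_2_add[of "w m" u] u by simp
  next
    case False
    have "q \<noteq> 0" using Suc.prems(2) False by (cases "q = 0") auto
    then obtain p where p: "q = Suc p" using not0_implies_Suc by blast
    obtain u where u: "w m = t + u" using False by (metis le_Suc_ex nat_le_linear)
    obtain v where v: "n = w m + v" using Suc.prems(1)[of m] le_Suc_ex by blast
    have "(\<Sum>i<m. w i choose 2) \<le> p * (n choose 2) + ((t + v) choose 2)"
      using Suc.prems u v p by (intro Suc.IH) auto
    \<comment> \<open>The exchange step: sizes \<open>t + v\<close> and \<open>t + u\<close> are
      replaced by the more unequal pair \<open>n\<close> and \<open>t\<close> with the same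
      sum.\<close>
    moreover have "((t + v) choose 2) + ((t + u) choose 2) \<le> (((t + u) + v) choose 2) + (t choose 2)"
      unfolding choose_2_add by (simp add: algebra_simps)
    ultimately show ?thesis using u v p by simp
  qed
qed simp

lemma card_complete_edges: "finite V \<Longrightarrow> card (complete_edges V) = card V choose 2"
  unfolding complete_edges_def by (rule n_subsets)

lemma finite_complete_edges: "finite V \<Longrightarrow> finite (complete_edges V)"
  unfolding complete_edges_def by (rule finite_subset[of _ "Pow V"]) auto

text \<open>Any \<open>k\<close> coordinates of an MDS code form an information set, and
  \<open>Y\<close> lies in such a set.\<close>

lemma mds_code_words_subset:
  assumes M: "mds_code X k M" and Y: "Y \<subseteq> X" "card Y \<le> k"
  shows "words Y \<subseteq> puncture M Y"
proof -
  have code: "linear_code X M" and dim: "fvec.dim M = k" and k: "k \<le> card X"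
    and dmin: "dmin M = card X - k + 1"
    using M by (auto simp: mds_code_def)
  have X: "finite X" using code by (simp add: linear_code_def)
  obtain Z where Z: "Y \<subseteq> Z" "Z \<subseteq> X" "card Z = k"
    using exists_subset_between[OF Y(2) k Y(1) X] by blast
  have fin: "finite Z" using Z X finite_subset by blast
  obtain J where J: "J \<subseteq> Z" "words J \<subseteq> puncture M J" "card J = code_rank M Z"
    using information_set[OF code fin] by metis
  have "\<not> code_rank M Z < k"
    using card_add_dmin_le[OF code Z(2)] dim dmin k Z(3) by auto
  then have "card J = card Z" using J(3) code_rank_le_card[OF code fin] Z(3) by simp
  then have "J = Z" using J(1) fin by (simp add: card_subset_eq)
  then have "words Z \<subseteq> puncture M Z" using J by simp
  show ?thesis
  proof
    fix w :: "'a \<Rightarrow> 'b" assume w: "w \<in> words Y"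
    then have "w \<in> words Z" using Z by (auto simp: words_def)
    then obtain a where a: "a \<in> M" "w = restr Z a"
      using \<open>words Z \<subseteq> puncture M Z\<close> by (auto simp: puncture_eq)
    have "w = restr Y w" using w by (auto simp: words_def restr_def)
    also have "\<dots> = restr Y a" using a(2) Z(1) by (auto simp: restr_def fun_eq_iff)
    finally show "w \<in> puncture M Y" using a(1) by (simp add: puncture_eq)
  qed
qed

text \<open>Row rank equals column rank: an information set supplies \<open>fvec.dim C\<close>
  independent columns, and columns of that height cannot have larger rank.\<close>

lemma dim_gcol:
  assumes C: "linear_code X C" and G: "gen_matrix (fvec.dim C) G C"
  shows "fvec.dim (gcol (fvec.dim C) G ` X) = fvec.dim C"
proof -
  let ?K = "fvec.dim C"
  have X: "finite X" using C by (simp add: linear_code_def)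
  have sub: "gcol ?K G ` S \<subseteq> words {..<?K}" for S
    by (auto simp: gcol_def words_def)
  have span: "linear_code {..<?K} (fvec.span (gcol ?K G ` X))"
    using fvec.span_minimal[OF sub subspace_words] by (simp add: linear_code_def)
  obtain J where J: "J \<subseteq> X" "words J \<subseteq> puncture C J" "card J = ?K"
    using information_set[OF C X] code_rank_full[OF C] by metis
  have ind: "indep_family (gcol ?K G) J"
    using J X by (intro indep_columns[OF G]) (auto intro: finite_subset)
  then have "?K = fvec.dim (gcol ?K G ` J)"
    using J(3) by (simp add: indep_family_def fvec.dim_eq_card_independent card_image)
  also have "\<dots> \<le> fvec.dim (fvec.span (gcol ?K G ` X))"
    using J(1) by (intro dim_subset[OF span]) (auto intro: fvec.span_base)
  finally show ?thesis
    using linear_code_dim_le[OF span] by simp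
qed

section \<open>Encoding scalar words as node words\<close>

definition node_word ::
  "'v set \<Rightarrow> nat \<Rightarrow> ('v set \<Rightarrow> 'i) \<Rightarrow> ('v \<Rightarrow> nat \<Rightarrow> 'v set) \<Rightarrow> ('i \<Rightarrow> 'f::field) \<Rightarrow> 'v \<times> nat \<Rightarrow> 'f" where
  "node_word V \<alpha> pl slot a = (\<lambda>(v, j). if v \<in> V \<and> j < \<alpha> then a (pl (slot v j)) else 0)"

lemma node_code_eq: "node_code V \<alpha> pl slot A = node_word V \<alpha> pl slot ` A"
  by (simp add: node_code_def node_word_def)

lemma linear_node_word: "Vector_Spaces.linear fscale fscale (node_word V \<alpha> pl slot)"
  by (rule fvec_linearI) (auto simp: node_word_def fscale_def fun_eq_iff)

lemma symb_node_word:
  "symb (node_word V \<alpha> pl slot a) v = (\<lambda>j. if v \<in> V \<and> j < \<alpha> then a (pl (slot v j)) else 0)"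
  by (simp add: symb_def node_word_def)

text \<open>\<open>K\<close> is written in a form free of subtraction from the message size: it
  counts the edges meeting \<open>r\<close> of \<open>n\<close> vertices. The
  \<open>(\<delta> - 1) choose 2\<close> other edges account for the local distance in
  \<open>dmin_A\<close>. Keeping \<open>m\<close> and \<open>l\<close> general lets
  \<open>m = l = 1\<close> cover a single local code.\<close>

locale edge_code =
  fixes A :: "('i \<Rightarrow> 'f::field) set" and X :: "'i set" and m l r \<delta> n K \<alpha> :: nat
    and V :: "nat \<Rightarrow> 'v set" and P :: "nat \<Rightarrow> 'i set" and pl slot
  assumes code: "linear_code X A"
    and pos: "1 \<le> r" "2 \<le> \<delta>" "1 \<le> l" "l \<le> m"
    and n_def: "n = r + \<delta> - 1" and \<alpha>_def: "\<alpha> = n - 1"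
    and K_def: "K = (r choose 2) + r * (\<delta> - 1)"
    and dim_A: "fvec.dim A = l * K"
    and dmin_A: "dmin A = ((\<delta> - 1) choose 2) + 1 + (m - l) * (n choose 2)"
    and X_eq: "(\<Union>i<m. P i) = X"
    and disj_P: "disjoint_family_on P {..<m}" and disj_V: "disjoint_family_on V {..<m}"
    and V: "i < m \<Longrightarrow> finite (V i)" "i < m \<Longrightarrow> card (V i) = n"
    and placement: "i < m \<Longrightarrow> edge_placement (V i) (P i) pl slot"
    and mds: "i < m \<Longrightarrow> mds_code (P i) K (puncture A (P i))"
begin

abbreviation W where "W \<equiv> \<Union>i<m. V i"

abbreviation E where "E \<equiv> node_word W \<alpha> pl slot"

abbreviation C where "C \<equiv> node_code W \<alpha> pl slot A"

lemma C_eq: "C = E ` A"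
  by (rule node_code_eq)

text \<open>The symbols of one node belong to one MDS code of dimension \<open>K\<close>; this bound
  makes them independent.\<close>

lemma K_ge: "\<alpha> \<le> K"
proof -
  obtain s where s: "r = Suc s" using pos by (cases r) auto
  show ?thesis using s by (simp add: n_def \<alpha>_def K_def numeral_2_eq_2)
qed

lemma K_pos: "0 < K"
  using K_ge pos by (auto simp: n_def \<alpha>_def)

lemma choose_n: "n choose 2 = K + ((\<delta> - 1) choose 2)"
  using choose_2_add[of r "\<delta> - 1"] pos by (simp add: n_def K_def)

lemma finite_P: "i < m \<Longrightarrow> finite (P i)"
  using mds by (auto simp: mds_code_def linear_code_def)

lemma finite_W: "finite W"
  using V by simp

lemma pl_bij: "i < m \<Longrightarrow> bij_betw pl (complete_edges (V i)) (P i)"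
  using placement by (simp add: edge_placement_def)

lemma card_P: "i < m \<Longrightarrow> card (P i) = n choose 2"
  using bij_betw_same_card[OF pl_bij] card_complete_edges V by metis

lemma slot_bij:
  "i < m \<Longrightarrow> v \<in> V i \<Longrightarrow> bij_betw (slot v) {..<\<alpha>} {e \<in> complete_edges (V i). v \<in> e}"
  using placement V by (auto simp: edge_placement_def \<alpha>_def)

lemma slot_edge:
  assumes "i < m" "v \<in> V i" "j < \<alpha>"
  shows "slot v j \<in> complete_edges (V i)" "v \<in> slot v j" "pl (slot v j) \<in> P i"
proof -
  have "slot v j \<in> {e \<in> complete_edges (V i). v \<in> e}"
    using slot_bij[OF assms(1,2)] assms(3) by (auto simp: bij_betw_def)
  then show "slot v j \<in> complete_edges (V i)" "v \<in> slot v j" by auto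
  then show "pl (slot v j) \<in> P i"
    using pl_bij[OF assms(1)] by (auto simp: bij_betw_def)
qed

lemma edge_slot:
  assumes "i < m" "v \<in> e" "e \<in> complete_edges (V i)"
  shows "\<exists>j<\<alpha>. slot v j = e"
proof -
  have "v \<in> V i" using assms by (auto simp: complete_edges_def)
  then have "e \<in> slot v ` {..<\<alpha>}"
    using slot_bij[OF assms(1)] assms by (auto simp: bij_betw_def)
  then show ?thesis by auto
qed

lemma symb_E_eq_0_iff:
  assumes "i < m" "v \<in> V i"
  shows "symb (E a) v = 0 \<longleftrightarrow> (\<forall>e\<in>complete_edges (V i). v \<in> e \<longrightarrow> a (pl e) = 0)"
proof
  assume zero: "symb (E a) v = 0"
  show "\<forall>e\<in>complete_edges (V i). v \<in> e \<longrightarrow> a (pl e) = 0"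
  proof (intro ballI impI)
    fix e assume e: "e \<in> complete_edges (V i)" "v \<in> e"
    then obtain j where j: "j < \<alpha>" "slot v j = e" using edge_slot assms by blast
    have "v \<in> W" using assms by auto
    then show "a (pl e) = 0" using fun_cong[OF zero, of j] j by (simp add: symb_node_word)
  qed
next
  assume "\<forall>e\<in>complete_edges (V i). v \<in> e \<longrightarrow> a (pl e) = 0"
  then show "symb (E a) v = 0"
    using slot_edge(1,2)[OF assms] by (auto simp: symb_node_word fun_eq_iff)
qed

lemma symb_E_outside: "v \<notin> W \<Longrightarrow> symb (E a) v = 0"
  by (auto simp: symb_node_word fun_eq_iff)

section \<open>Lower bound on the node weight\<close>

definition active :: "('i \<Rightarrow> 'f) \<Rightarrow> nat \<Rightarrow> 'v set" where
  "active a i = {v \<in> V i. symb (E a) v \<noteq> 0}"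

lemma finite_active: "i < m \<Longrightarrow> finite (active a i)"
  using V by (simp add: active_def)

lemma card_active: "card {v. symb (E a) v \<noteq> 0} = (\<Sum>i<m. card (active a i))"
proof -
  have "{v. symb (E a) v \<noteq> 0} = (\<Union>i<m. active a i)"
    using symb_E_outside by (auto simp: active_def)
  also have "card \<dots> = (\<Sum>i<m. card (active a i))"
  proof (rule card_UN_disjoint)
    show "\<forall>i\<in>{..<m}. \<forall>j\<in>{..<m}. i \<noteq> j \<longrightarrow> active a i \<inter> active a j = {}"
      using disj_V unfolding disjoint_family_on_def active_def by blast
  qed (use finite_active in auto)
  finally show ?thesis .
qed

lemma weight_le:
  assumes a: "a \<in> A"
  shows "card {x. a x \<noteq> 0} \<le> (\<Sum>i<m. card (active a i) choose 2)"
proof -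
  have "{x. a x \<noteq> 0} \<subseteq> (\<Union>i<m. pl ` complete_edges (active a i))"
  proof
    fix x assume x: "x \<in> {x. a x \<noteq> 0}"
    then have "x \<in> X" using a code by (auto simp: linear_code_def words_def)
    then obtain i where i: "i < m" "x \<in> P i" using X_eq by auto
    then obtain e where e: "e \<in> complete_edges (V i)" "x = pl e"
      using pl_bij[OF i(1)] by (auto simp: bij_betw_def)
    have "e \<subseteq> active a i"
    proof
      fix v assume v: "v \<in> e"
      then have "v \<in> V i" using e by (auto simp: complete_edges_def)
      moreover have "symb (E a) v \<noteq> 0"
        using symb_E_eq_0_iff[OF i(1) \<open>v \<in> V i\<close>, of a] e v x by blast
      ultimately show "v \<in> active a i" by (simp add: active_def)
    qed
    then have "e \<in> complete_edges (active a i)" using e by (simp add: complete_edges_def)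
    then show "x \<in> (\<Union>i<m. pl ` complete_edges (active a i))" using e i by blast
  qed
  moreover have "finite (\<Union>i<m. pl ` complete_edges (active a i))"
    using finite_active by (simp add: finite_complete_edges)
  ultimately have "card {x. a x \<noteq> 0} \<le> card (\<Union>i<m. pl ` complete_edges (active a i))"
    by (rule card_mono[rotated])
  also have "\<dots> \<le> (\<Sum>i<m. card (pl ` complete_edges (active a i)))"
    by (rule card_UN_le) simp
  also have "\<dots> \<le> (\<Sum>i<m. card (active a i) choose 2)"
    using finite_active
    by (intro sum_mono) (metis card_complete_edges card_image_le finite_complete_edges lessThan_iff)
  finally show ?thesis .
qed

lemma dmin_le_weight: "a \<in> A \<Longrightarrow> a \<noteq> 0 \<Longrightarrow> dmin A \<le> card {x. a x \<noteq> 0}"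
  unfolding dmin_def by (rule min_weight_le)

lemma node_weight_ge:
  assumes a: "a \<in> A" "a \<noteq> 0"
  shows "(m - l) * n + \<delta> \<le> card {v. symb (E a) v \<noteq> 0}"
proof (rule ccontr)
  assume "\<not> ?thesis"
  then have "(\<Sum>i<m. card (active a i)) \<le> (m - l) * n + (\<delta> - 1)"
    using card_active[of a] pos by simp
  moreover have "card (active a i) \<le> n" if "i < m" for i
    using V[OF that] card_mono[of "V i" "active a i"] by (auto simp: active_def)
  \<comment> \<open>The worst case is \<open>m - l\<close> full graphs and
    \<open>\<delta> - 1\<close> nodes of another; their edges number exactly
    \<open>dmin A - 1\<close>.\<close>
  ultimately have "(\<Sum>i<m. card (active a i) choose 2) \<le> (m - l) * (n choose 2) + ((\<delta> - 1) choose 2)"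
    using pos by (intro sum_choose_2_le) (auto simp: n_def)
  then show False
    using weight_le[OF a(1)] dmin_le_weight[OF a] dmin_A by simp
qed

text \<open>The weight bound is positive, so injectivity of the encoding comes with it.\<close>

lemma E_nonzero:
  assumes "a \<in> A" "a \<noteq> 0"
  shows "E a \<noteq> 0"
proof
  assume "E a = 0"
  then have "{v. symb (E a) v \<noteq> 0} = {}" by (auto simp: symb_def fun_eq_iff)
  then show False using node_weight_ge[OF assms] pos by simp
qed

lemma inj_E: "inj_on E A"
  using code E_nonzero by (intro inj_on_linear[OF linear_node_word]) (auto simp: linear_code_def)

lemma linear_code_C: "linear_code (W \<times> {..<\<alpha>}) C"
proof -
  have "fvec.subspace C"
    unfolding C_eq using code by (intro subspace_linear_image linear_node_word) (simp add: linear_code_def)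
  moreover have "C \<subseteq> words (W \<times> {..<\<alpha>})"
    by (auto simp: C_eq words_def node_word_def)
  ultimately show ?thesis using finite_W by (simp add: linear_code_def)
qed

lemma dim_C: "fvec.dim C = l * K"
  using dim_linear_inj_image[OF linear_node_word _ inj_E] code dim_A
  by (simp add: C_eq linear_code_def)

lemma card_W: "card W = m * n"
proof -
  have "card W = (\<Sum>i<m. card (V i))"
    using V disj_V by (intro card_UN_disjoint) (auto simp: disjoint_family_on_def)
  then show ?thesis using V by simp
qed

text \<open>This yields the standing assumption on thick columns: the contents of a single node can
  be prescribed freely.\<close>

lemma node_symbols_independent:
  assumes v: "v \<in> W"
  shows "words ({v} \<times> {..<\<alpha>}) \<subseteq> puncture C ({v} \<times> {..<\<alpha>})"
proof
  fix w :: "'v \<times> nat \<Rightarrow> 'f" assume w: "w \<in> words ({v} \<times> {..<\<alpha>})"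
  obtain i where i: "i < m" "v \<in> V i" using v by auto
  define f where "f j = pl (slot v j)" for j
  have inj: "inj_on f {..<\<alpha>}"
  proof (rule inj_onI)
    fix j k assume jk: "j \<in> {..<\<alpha>}" "k \<in> {..<\<alpha>}" "f j = f k"
    then have "slot v j = slot v k"
      using slot_edge[OF i] pl_bij[OF i(1)] by (auto simp: f_def bij_betw_def inj_on_def)
    then show "j = k" using jk slot_bij[OF i] by (auto simp: bij_betw_def inj_on_def)
  qed
  define Y where "Y = f ` {..<\<alpha>}"
  have Y: "Y \<subseteq> P i" "card Y \<le> K"
    using slot_edge[OF i] K_ge card_image[OF inj] by (auto simp: Y_def f_def)
  \<comment> \<open>The prescribed node contents, carried back to the scalar coordinates of the
    incident edges.\<close>
  define b where "b x = (if x \<in> Y then w (v, the_inv_into {..<\<alpha>} f x) else 0)" for x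
  have "b \<in> words Y" by (simp add: b_def words_def)
  then obtain a where a: "a \<in> A" "b = restr Y a"
    using mds_code_words_subset[OF mds[OF i(1)] Y] puncture_puncture[of A "P i" Y] Y(1)
    by (auto simp: Int_absorb1 puncture_eq)
  have "w (v, j) = a (f j)" if "j < \<alpha>" for j
    using that fun_cong[OF a(2), of "f j"] the_inv_into_f_f[OF inj, of j]
    by (auto simp: b_def Y_def restr_def)
  then have "w = restr ({v} \<times> {..<\<alpha>}) (E a)"
    using w v by (auto simp: words_def restr_def node_word_def f_def fun_eq_iff)
  then show "w \<in> puncture C ({v} \<times> {..<\<alpha>})" using a(1) by (simp add: puncture_eq C_eq)
qed

lemma vector_code_C: "vector_code W \<alpha> C"
proof -
  obtain G where G: "gen_matrix (fvec.dim C) G C"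
    using gen_matrix_exists[OF linear_code_C] by blast
  have "\<forall>v\<in>W. indep_family (gcol (fvec.dim C) G) ({v} \<times> {..<\<alpha>})"
    using indep_columns[OF G _ node_symbols_independent] by simp
  then show ?thesis
    using G linear_code_C finite_W by (auto simp: vector_code_def)
qed

text \<open>Information sets of the graphs before \<open>l - 1\<close>, together with all edges
  meeting \<open>r - 1\<close> nodes of graph \<open>l - 1\<close>, have fewer than
  \<open>l * K\<close> coordinates. A nonzero codeword vanishing on them lives on the remaining
  \<open>\<delta>\<close> nodes of that graph and the \<open>m - l\<close> graphs after it.\<close>

lemma low_weight_node_word:
  obtains a where "a \<in> A" "a \<noteq> 0" "card {v. symb (E a) v \<noteq> 0} \<le> (m - l) * n + \<delta>"
proof -
  let ?q = "l - 1"
  have q: "?q < m" using pos by simp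
  have "\<exists>J. J \<subseteq> P i \<and> determines A J (P i) \<and> card J = K" if "i < m" for i
    using information_set[OF code finite_P[OF that]] mds[OF that]
    by (metis code_rank_def mds_code_def)
  then obtain J where J: "\<And>i. i < m \<Longrightarrow> J i \<subseteq> P i" "\<And>i. i < m \<Longrightarrow> determines A (J i) (P i)"
      "\<And>i. i < m \<Longrightarrow> card (J i) = K"
    by metis
  obtain Z where Z: "Z \<subseteq> V ?q" "card Z = r - 1" "finite Z"
    using obtain_subset_with_card_n[of "r - 1" "V ?q"] V[OF q] n_def pos
    by (metis add_leD1 diff_le_mono le_add1)
  \<comment> \<open>The edges meeting \<open>Z\<close>, as the complement of those avoiding
    it.\<close>
  define F where "F = complete_edges (V ?q) - complete_edges (V ?q - Z)"
  have finV: "finite (V ?q)" by (rule V(1)[OF q])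
  have cardVZ: "card (V ?q - Z) = \<delta>"
    using Z V[OF q] pos by (simp add: card_Diff_subset n_def)
  have "complete_edges (V ?q - Z) \<subseteq> complete_edges (V ?q)" by (auto simp: complete_edges_def)
  then have "card F = (n choose 2) - (\<delta> choose 2)"
    unfolding F_def using finV cardVZ V(2)[OF q]
    by (simp add: card_Diff_subset finite_complete_edges card_complete_edges)
  moreover have "n choose 2 = ((r - 1) choose 2) + (\<delta> choose 2) + (r - 1) * \<delta>"
    using choose_2_add[of "r - 1" \<delta>] pos by (simp add: n_def)
  \<comment> \<open>The two sides differ by \<open>\<delta> - 1\<close>.\<close>
  moreover have "((r - 1) choose 2) + (r - 1) * \<delta> < K"
  proof -
    obtain s where s: "r = Suc s" using pos by (cases r) auto
    obtain t where t: "\<delta> = Suc (Suc t)" using pos by (metis add_2_eq_Suc le_Suc_ex)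
    show ?thesis using s t by (simp add: K_def numeral_2_eq_2 algebra_simps)
  qed
  ultimately have cardF: "card F < K" by linarith
  have finF: "finite F" using finV by (simp add: F_def finite_complete_edges)
  define T where "T = (\<Union>i<?q. J i) \<union> pl ` F"
  have finJ: "finite (J i)" if "i < m" for i using J(1)[OF that] finite_P[OF that] finite_subset by blast
  have finT: "finite T" using finJ q finF by (auto simp: T_def)
  have "card T \<le> card (\<Union>i<?q. J i) + card (pl ` F)" unfolding T_def by (rule card_Un_le)
  also have "\<dots> \<le> (\<Sum>i<?q. card (J i)) + card F"
    by (intro add_mono card_UN_le card_image_le finF) simp
  also have "\<dots> = ?q * K + card F" using J(3) q by simp
  also have "\<dots> < ?q * K + K" using cardF by simp
  also have "\<dots> = l * K" using pos by (cases l) auto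
  finally have "code_rank A T < fvec.dim A"
    using code_rank_le_card[OF code finT] dim_A by linarith
  then obtain a where a: "a \<in> A" "a \<noteq> 0" "\<And>x. x \<in> T \<Longrightarrow> a x = 0"
    using nonzero_word_vanishing[OF code finT] by metis
  have zero: "symb (E a) v = 0" if i: "i < ?q" and v: "v \<in> V i" for i v
  proof -
    have im: "i < m" using i q by simp
    have "\<forall>x\<in>J i. a x = 0" using a(3) i by (auto simp: T_def)
    then have "\<forall>x\<in>P i. a x = 0" using J(2)[OF im] a(1) by (simp add: determines_def)
    then show ?thesis
      using symb_E_eq_0_iff[OF im v] pl_bij[OF im] by (auto simp: bij_betw_def)
  qed
  have zeroZ: "symb (E a) v = 0" if "v \<in> Z" for v
  proof -
    have v: "v \<in> V ?q" using that Z by blast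
    have "a (pl e) = 0" if "e \<in> complete_edges (V ?q)" "v \<in> e" for e
      using that \<open>v \<in> Z\<close> by (intro a(3)) (auto simp: T_def F_def complete_edges_def)
    then show ?thesis using symb_E_eq_0_iff[OF q v] by blast
  qed
  have "{v. symb (E a) v \<noteq> 0} \<subseteq> (\<Union>i\<in>{l..<m}. V i) \<union> (V ?q - Z)"
  proof
    fix v assume v: "v \<in> {v. symb (E a) v \<noteq> 0}"
    then have "v \<in> W" using symb_E_outside by auto
    then obtain i where i: "i < m" "v \<in> V i" by auto
    then have "\<not> i < ?q" using zero v by auto
    then consider "i = ?q" | "l \<le> i" by linarith
    then show "v \<in> (\<Union>i\<in>{l..<m}. V i) \<union> (V ?q - Z)"
      using i v zeroZ by cases auto
  qed
  moreover have "finite ((\<Union>i\<in>{l..<m}. V i) \<union> (V ?q - Z))"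
    using V finV by auto
  ultimately have "card {v. symb (E a) v \<noteq> 0} \<le> card ((\<Union>i\<in>{l..<m}. V i) \<union> (V ?q - Z))"
    by (rule card_mono[rotated])
  also have "\<dots> \<le> card (\<Union>i\<in>{l..<m}. V i) + card (V ?q - Z)" by (rule card_Un_le)
  also have "\<dots> \<le> (\<Sum>i\<in>{l..<m}. card (V i)) + \<delta>"
    using cardVZ by (simp add: card_UN_le)
  also have "(\<Sum>i\<in>{l..<m}. card (V i)) = (m - l) * n" using V by simp
  finally show ?thesis using a that by blast
qed

lemma vdmin_C: "vdmin C = (m - l) * n + \<delta>"
proof -
  obtain a where a: "a \<in> A" "a \<noteq> 0" "card {v. symb (E a) v \<noteq> 0} \<le> (m - l) * n + \<delta>"
    by (rule low_weight_node_word)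
  have aC: "E a \<in> C" "E a \<noteq> 0" using a E_nonzero by (auto simp: C_eq)
  have "vdmin C \<le> card {v. symb (E a) v \<noteq> 0}"
    unfolding vdmin_def by (rule min_weight_le[OF aC])
  moreover have "(m - l) * n + \<delta> \<le> vdmin C"
    unfolding vdmin_def
  proof (rule min_weight_ge[OF aC])
    fix c assume c: "c \<in> C" "c \<noteq> 0"
    then obtain b where b: "b \<in> A" "c = E b" by (auto simp: C_eq)
    have "E 0 = 0" by (auto simp: node_word_def fun_eq_iff)
    then have "b \<noteq> 0" using b c by auto
    then show "(m - l) * n + \<delta> \<le> card {v. symb c v \<noteq> 0}" using node_weight_ge b by blast
  qed
  ultimately show ?thesis using a(3) by linarith
qed

text \<open>Edges at nodes of \<open>V i\<close> carry only coordinates in \<open>P i\<close>, so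
  puncturing commutes with the placement.\<close>

lemma vpuncture_C:
  assumes "i < m"
  shows "vpuncture C (V i) = node_code (V i) \<alpha> pl slot (puncture A (P i))"
proof -
  have "restr (V i \<times> UNIV) (E a) = node_word (V i) \<alpha> pl slot (restr (P i) a)" for a :: "'i \<Rightarrow> 'f"
    using slot_edge(3)[OF assms] assms by (auto simp: restr_def node_word_def fun_eq_iff)
  then show ?thesis
    by (simp add: vpuncture_def puncture_eq C_eq node_code_eq image_image)
qed

text \<open>With \<open>m = l = 1\<close> all results on the node code apply to each local
  code.\<close>

lemma local_edge_code:
  assumes "i < m"
  shows "edge_code (puncture A (P i)) (P i) 1 1 r \<delta> n K \<alpha> (\<lambda>_. V i) (\<lambda>_. P i) pl slot"
  using mds[OF assms] V[OF assms] placement[OF assms] card_P[OF assms] choose_n pos n_def \<alpha>_def K_def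
  by unfold_locales (auto simp: mds_code_def puncture_puncture disjoint_family_on_def)

text \<open>Codewords agreeing on \<open>r\<close> nodes differ in at most
  \<open>n - r = \<delta> - 1\<close> nodes, fewer than \<open>vdmin C\<close>. Repair copies from
  each other node the symbol on the shared edge.\<close>

lemma regenerating_code_C:
  assumes m: "m = 1"
  shows "regenerating_code n r \<alpha> \<alpha> 1 K W C"
proof -
  have l: "l = 1" using pos m by simp
  have recover: "c = c'"
    if S: "S \<subseteq> W" "card S = r" and c: "c \<in> C" "c' \<in> C" "\<forall>v\<in>S. symb c v = symb c' v" for S c c'
  proof (rule ccontr)
    assume ne: "c \<noteq> c'"
    have "c - c' \<in> C"
      using linear_code_C c by (simp add: linear_code_def fvec.subspace_diff)
    moreover have "c - c' \<noteq> 0" using ne by simp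
    ultimately have "vdmin C \<le> card {v. symb (c - c') v \<noteq> 0}"
      unfolding vdmin_def by (rule min_weight_le)
    also have "\<dots> \<le> card (W - S)"
    proof (rule card_mono)
      have "symb (c - c') v = symb c v - symb c' v" for v
        by (simp add: symb_def fun_eq_iff)
      moreover have "symb c v = 0 \<and> symb c' v = 0" if "v \<notin> W" for v
        using c(1,2) symb_E_outside[OF that] unfolding C_eq by blast
      ultimately show "{v. symb (c - c') v \<noteq> 0} \<subseteq> W - S" using c(3) by fastforce
    qed (use finite_W in simp)
    also have "\<dots> = n - r"
      using S card_W m card_Diff_subset[OF finite_subset[OF S(1) finite_W] S(1)] by simp
    finally show False using vdmin_C l m pos by (simp add: n_def)
  qed
  have repair: "\<exists>\<phi> :: 'v \<Rightarrow> (nat \<Rightarrow> 'f) \<Rightarrow> (nat \<Rightarrow> 'f).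
      (\<forall>h\<in>D. Vector_Spaces.linear fscale fscale (\<phi> h) \<and> \<phi> h ` words {..<\<alpha>} \<subseteq> words {..<1}) \<and>
      (\<forall>c\<in>C. \<forall>c'\<in>C. (\<forall>h\<in>D. \<phi> h (symb c h) = \<phi> h (symb c' h)) \<longrightarrow> symb c u = symb c' u)"
    if u: "u \<in> W" and D: "D \<subseteq> W - {u}" "card D = \<alpha>" for u D
  proof -
    have W: "W = V 0" "0 < m" using m by auto
    have "card (W - {u}) = \<alpha>" using u finite_W card_W m by (simp add: \<alpha>_def)
    \<comment> \<open>With \<open>n - 1\<close> helpers every other node helps, so each edge at
      \<open>u\<close> ends in a helper.\<close>
    then have D_eq: "D = W - {u}" using D finite_W by (intro card_subset_eq) auto
    have "\<exists>j<\<alpha>. slot h j = {u, h}" if "h \<in> D" for h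
      using that u D_eq W by (intro edge_slot[OF W(2)]) (auto simp: complete_edges_def)
    then obtain s where s: "\<And>h. h \<in> D \<Longrightarrow> s h < \<alpha>" "\<And>h. h \<in> D \<Longrightarrow> slot h (s h) = {u, h}"
      by metis
    \<comment> \<open>Node \<open>h\<close> sends the component \<open>s h\<close>, the symbol on
      the edge to \<open>u\<close>, in the single position 0.\<close>
    define \<phi> :: "'v \<Rightarrow> (nat \<Rightarrow> 'f) \<Rightarrow> (nat \<Rightarrow> 'f)" where
      "\<phi> h x = (\<lambda>t. if t = 0 then x (s h) else 0)" for h x
    have lin: "Vector_Spaces.linear fscale fscale (\<phi> h)" for h
      by (rule fvec_linearI) (auto simp: \<phi>_def fscale_def fun_eq_iff)
    have img: "\<phi> h ` words {..<\<alpha>} \<subseteq> words {..<1}" for h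
      by (auto simp: \<phi>_def words_def)
    have det: "symb c u = symb c' u"
      if c: "c \<in> C" "c' \<in> C" and eq: "\<forall>h\<in>D. \<phi> h (symb c h) = \<phi> h (symb c' h)" for c c'
    proof -
      obtain a a' where a: "c = E a" "c' = E a'" using c by (auto simp: C_eq)
      have "a (pl (slot u j)) = a' (pl (slot u j))" if j: "j < \<alpha>" for j
      proof -
        have u0: "u \<in> V 0" using u W by simp
        have "slot u j \<subseteq> W" "card (slot u j) = 2" "u \<in> slot u j"
          using slot_edge[OF W(2) u0 j] W by (auto simp: complete_edges_def)
        then obtain h where h: "slot u j = {u, h}" "h \<noteq> u" "h \<in> W"
          unfolding card_2_iff by (metis insert_commute insert_iff singletonD subset_iff)
        then have hD: "h \<in> D" using D_eq by simp
        have "\<phi> h (symb c h) 0 = \<phi> h (symb c' h) 0" using eq hD by simp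
        then have "symb c h (s h) = symb c' h (s h)" by (simp add: \<phi>_def)
        moreover have "symb (E b) h (s h) = b (pl (slot u j))" for b :: "'i \<Rightarrow> 'f"
          using s[OF hD] h by (simp add: symb_node_word)
        ultimately show ?thesis by (simp add: a)
      qed
      then show ?thesis unfolding a symb_node_word by auto
    qed
    show ?thesis
    proof (intro exI[of _ \<phi>] conjI ballI impI)
      fix c c' assume "c \<in> C" "c' \<in> C" "\<forall>h\<in>D. \<phi> h (symb c h) = \<phi> h (symb c' h)"
      then show "symb c u = symb c' u" by (rule det)
    qed (rule lin img)+
  qed
  have "r \<le> \<alpha>" "\<alpha> < n" using pos by (auto simp: n_def \<alpha>_def)
  then show ?thesis
    unfolding regenerating_code_def
    using vector_code_C card_W dim_C m l
    by (intro conjI allI ballI impI repair) (auto intro: recover)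
qed

text \<open>Both sides count the edges meeting \<open>r\<close> of the \<open>n\<close> vertices:
  taken one by one from index 0, vertex \<open>i\<close> contributes \<open>n - 1 - i\<close> new
  edges.\<close>

lemma sum_repair_bandwidth: "(\<Sum>i<r. \<alpha> - i) = K"
proof -
  have "(\<Sum>i<k. n - 1 - i) = (k choose 2) + k * (n - k)" if "k < n" for k
    using that
  proof (induction k)
    case (Suc k)
    then obtain t where "n = Suc (Suc k) + t" using le_Suc_ex[of "Suc (Suc k)" n] by auto
    with Suc show ?case by (simp add: numeral_2_eq_2 algebra_simps)
  qed simp
  then show ?thesis using pos by (simp add: n_def \<alpha>_def K_def)
qed

lemma MBR_code_C: "m = 1 \<Longrightarrow> MBR_code n r \<alpha> \<alpha> 1 K W C"
  using regenerating_code_C sum_repair_bandwidth by (simp add: MBR_code_def)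

lemma local_MBR_code:
  assumes "i < m"
  shows "MBR_code n r \<alpha> \<alpha> 1 K (V i) (vpuncture C (V i))"
    and "vdmin (vpuncture C (V i)) = \<delta>"
proof -
  have *: "(\<Union>j<1::nat. V i) = V i" by auto
  show "MBR_code n r \<alpha> \<alpha> 1 K (V i) (vpuncture C (V i))"
    using edge_code.MBR_code_C[OF local_edge_code[OF assms] refl]
    unfolding * vpuncture_C[OF assms] .
  show "vdmin (vpuncture C (V i)) = \<delta>"
    using edge_code.vdmin_C[OF local_edge_code[OF assms]]
    unfolding * vpuncture_C[OF assms] by simp
qed

lemma exact_information_locality_C: "exact_information_locality r \<delta> W \<alpha> C {..<m} V"
proof -
  obtain G where G: "gen_matrix (fvec.dim C) G C"
    using gen_matrix_exists[OF linear_code_C] by blast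
  have "thick_rank \<alpha> (fvec.dim C) G W = fvec.dim C"
    unfolding thick_rank_def by (rule dim_gcol[OF linear_code_C G])
  then show ?thesis
    using G vector_code_C V local_MBR_code(2)
    by (auto simp: exact_information_locality_def n_def)
qed

lemma MBR_local_code_C: "MBR_local_code r \<delta> \<alpha> 1 K W \<alpha> C m V"
  using exact_information_locality_C local_MBR_code(1)
  unfolding MBR_local_code_def n_def[symmetric] by simp

end


section \<open>Parameter arithmetic and assembly of the result\<close>

lemma double_choose_2: "r * (r - 1) = 2 * (r choose 2)"
proof (induction r)
  case (Suc r)
  then show ?case by (cases r) (auto simp: numeral_2_eq_2)
qed simp

text \<open>Rewrites \<open>K\<^sub>L\<close> and \<open>N\<^sub>L\<close> as sums, away from
  truncated subtraction of binomials.\<close>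

lemma choose_2_parameters:
  fixes r \<delta> :: nat
  assumes "1 \<le> r" "2 \<le> \<delta>"
  shows "r * (r + \<delta> - 1 - 1) - (r choose 2) = (r choose 2) + r * (\<delta> - 1)"
    and "(r + \<delta> - 1) choose 2 = (r choose 2) + r * (\<delta> - 1) + ((\<delta> - 1) choose 2)"
proof -
  have "r + \<delta> - 1 - 1 = (r - 1) + (\<delta> - 1)" using assms by simp
  then have "r * (r + \<delta> - 1 - 1) = 2 * (r choose 2) + r * (\<delta> - 1)"
    using double_choose_2[of r] by (simp add: distrib_left)
  then show "r * (r + \<delta> - 1 - 1) - (r choose 2) = (r choose 2) + r * (\<delta> - 1)" by simp
  show "(r + \<delta> - 1) choose 2 = (r choose 2) + r * (\<delta> - 1) + ((\<delta> - 1) choose 2)"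
    using choose_2_add[of r "\<delta> - 1"] assms by simp
qed

text \<open>The concrete partition for the case where the scalar code is itself MDS.\<close>

lemma blocks_partition:
  fixes m N :: nat
  shows "(\<Union>i<m. {i * N..<i * N + N}) = {..<m * N}"
    and "disjoint_family_on (\<lambda>i. {i * N..<i * N + N}) {..<m}"
proof -
  have bound: "i * N + N \<le> j * N" if "i < j" for i j
    using mult_le_mono1[of "Suc i" j N] that by simp
  show "(\<Union>i<m. {i * N..<i * N + N}) = {..<m * N}"
  proof (intro subset_antisym subsetI)
    fix x assume x: "x \<in> {..<m * N}"
    then have N: "0 < N" by (cases N) auto
    have "x div N < m" using x by (simp add: less_mult_imp_div_less)
    moreover have "x \<in> {x div N * N..<x div N * N + N}"
      using div_mult_mod_eq[of x N] mod_less_divisor[OF N, of x] by (auto simp only: atLeastLessThan_iff)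
    ultimately show "x \<in> (\<Union>i<m. {i * N..<i * N + N})" by blast
  qed (use bound in fastforce)
  show "disjoint_family_on (\<lambda>i. {i * N..<i * N + N}) {..<m}"
    unfolding disjoint_family_on_def
  proof (intro ballI impI)
    fix i j :: nat assume "i \<noteq> j"
    then consider "i < j" | "j < i" by linarith
    then show "{i * N..<i * N + N} \<inter> {j * N..<j * N + N} = {}"
      using bound[of i j] bound[of j i] by cases auto
  qed
qed

text \<open>A decomposition is shown to exist, and the claims on the node code then hold for every
  decomposition and every edge placement, not only for the one constructed.\<close>

theorem mainTheorem13:
  fixes A :: "(nat \<Rightarrow> 'f::{field,finite}) set"
    and r \<delta> m l n\<^sub>L \<alpha> d \<beta> K\<^sub>L N\<^sub>L \<Delta>\<^sub>L :: nat
  assumes "r \<ge> 1" and "\<delta> \<ge> 2" and "m \<ge> 1" and "l \<ge> 1" and "l \<le> m"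
    and "n\<^sub>L = r + \<delta> - 1" and "d = n\<^sub>L - 1" and "\<alpha> = d" and "\<beta> = 1"
    and "K\<^sub>L = r * \<alpha> - (r choose 2)" and "N\<^sub>L = n\<^sub>L choose 2" and "\<Delta>\<^sub>L = N\<^sub>L - K\<^sub>L + 1"
    and "linear_code {..<m * N\<^sub>L} A" and "fvec.dim A = l * K\<^sub>L"
    and "optimal_all_symbol_locality K\<^sub>L \<Delta>\<^sub>L {..<m * N\<^sub>L} A"
  shows "(\<exists>P. mds_decomposition m N\<^sub>L K\<^sub>L \<Delta>\<^sub>L {..<m * N\<^sub>L} A P) \<and>
    dmin A = \<Delta>\<^sub>L + (m - l) * N\<^sub>L \<and>
    (\<forall>P (V :: nat \<Rightarrow> 'v set) pl slot W C n K.
       mds_decomposition m N\<^sub>L K\<^sub>L \<Delta>\<^sub>L {..<m * N\<^sub>L} A P \<longrightarrow>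
       disjoint_family_on V {..<m} \<longrightarrow>
       (\<forall>i<m. finite (V i) \<and> card (V i) = n\<^sub>L \<and> edge_placement (V i) (P i) pl slot) \<longrightarrow>
       W = (\<Union>i<m. V i) \<longrightarrow> C = node_code W \<alpha> pl slot A \<longrightarrow>
       n = card W \<longrightarrow> K = fvec.dim C \<longrightarrow>
         MBR_local_code r \<delta> d \<beta> K\<^sub>L W \<alpha> C m V \<and>
         (\<forall>i<m. MBR_code n\<^sub>L r d \<alpha> \<beta> K\<^sub>L (V i) (vpuncture C (V i)) \<and>
                repair_by_transfer_code n\<^sub>L r (V i) (vpuncture C (V i))) \<and>
         n = m * n\<^sub>L \<and> K = l * K\<^sub>L \<and>
         real (vdmin C) = real n - real K / real K\<^sub>L * real r + 1
                            - (real K / real K\<^sub>L - 1) * (real \<delta> - 1) \<and>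
         vdmin C = (m - l) * n\<^sub>L + \<delta>)"
proof -
  note r = assms(1) and \<delta> = assms(2) and l = assms(4,5)
  have K: "K\<^sub>L = (r choose 2) + r * (\<delta> - 1)"
    using choose_2_parameters(1)[OF r \<delta>] assms(6-8,10) by simp
  have N: "N\<^sub>L = K\<^sub>L + ((\<delta> - 1) choose 2)"
    using choose_2_parameters(2)[OF r \<delta>] assms(6,11) K by simp
  have \<Delta>: "\<Delta>\<^sub>L = ((\<delta> - 1) choose 2) + 1" using assms(12) N by simp
  have K_pos: "0 < K\<^sub>L" using K r \<delta> by simp
  obtain \<S> where \<S>: "\<Union>\<S> = {..<m * N\<^sub>L}"
    "\<And>S. S \<in> \<S> \<Longrightarrow> card S \<le> K\<^sub>L + \<Delta>\<^sub>L - 1 \<and> dmin (puncture A S) \<ge> \<Delta>\<^sub>L"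
    using assms(15) unfolding optimal_all_symbol_locality_def all_symbol_locality_def by metis
  \<comment> \<open>The dimension is an exact multiple of \<open>K\<^sub>L\<close>, so rounding up
    changes nothing.\<close>
  have "\<lceil>real (fvec.dim A) / real K\<^sub>L\<rceil> = int l" using assms(14) K_pos by simp
  then have "int (dmin A) = int (m * N\<^sub>L) - int (l * K\<^sub>L) + 1 - (int l - 1) * (int \<Delta>\<^sub>L - 1)"
    using assms(14,15) by (simp add: optimal_all_symbol_locality_def)
  moreover have "(int l - 1) * (int \<Delta>\<^sub>L - 1) = int ((l - 1) * (\<Delta>\<^sub>L - 1))"
    using l(1) \<Delta> by (simp add: of_nat_diff)
  ultimately have opt: "m * N\<^sub>L + 1 = dmin A + l * K\<^sub>L + (l - 1) * (\<Delta>\<^sub>L - 1)" by linarith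
  have lrc: "optimal_lrc A {..<m * N\<^sub>L} \<S> l K\<^sub>L \<Delta>\<^sub>L"
    using assms(13,14) l(1) K_pos \<Delta> opt \<S> by unfold_locales auto
  have N': "N\<^sub>L = K\<^sub>L + \<Delta>\<^sub>L - 1" using N \<Delta> by simp
  have decomposition: "\<exists>P. mds_decomposition m N\<^sub>L K\<^sub>L \<Delta>\<^sub>L {..<m * N\<^sub>L} A P"
  \<comment> \<open>\<open>\<Delta>\<^sub>L = 1\<close> occurs precisely for
    \<open>\<delta> = 2\<close>. In this case, as for \<open>l = 1\<close>, the given local sets may
    overlap and consecutive blocks replace them.\<close>
  proof (cases "\<Delta>\<^sub>L = 1 \<or> l = 1")
    case True
    then show ?thesis
      using optimal_lrc.mds_decomposition_arbitrary[OF lrc True blocks_partition _ l(2), folded N']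
      by auto
  next
    case False
    then have "\<Delta>\<^sub>L \<noteq> 1" "l \<noteq> 1" by auto
    then have "2 \<le> \<Delta>\<^sub>L" "2 \<le> l" using \<Delta> l(1) by linarith+
    then show ?thesis
      using optimal_lrc.mds_decomposition_disjoint[OF lrc, of m, folded N'] by simp
  qed
  have dmin_A: "dmin A = \<Delta>\<^sub>L + (m - l) * N\<^sub>L"
  proof -
    obtain p where p: "m = l + p" using l(2) le_Suc_ex by blast
    obtain q where q: "l = Suc q" using l(1) by (cases l) auto
    show ?thesis using opt p q \<Delta> N by (simp add: algebra_simps)
  qed
  have node: "MBR_local_code r \<delta> d \<beta> K\<^sub>L W \<alpha> C m V \<and>
      (\<forall>i<m. MBR_code n\<^sub>L r d \<alpha> \<beta> K\<^sub>L (V i) (vpuncture C (V i)) \<and>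
             repair_by_transfer_code n\<^sub>L r (V i) (vpuncture C (V i))) \<and>
      n = m * n\<^sub>L \<and> k = l * K\<^sub>L \<and>
      real (vdmin C) = real n - real k / real K\<^sub>L * real r + 1
                         - (real k / real K\<^sub>L - 1) * (real \<delta> - 1) \<and>
      vdmin C = (m - l) * n\<^sub>L + \<delta>"
    if P: "mds_decomposition m N\<^sub>L K\<^sub>L \<Delta>\<^sub>L {..<m * N\<^sub>L} A P"
      and V: "disjoint_family_on V {..<m}"
        "\<forall>i<m. finite (V i) \<and> card (V i) = n\<^sub>L \<and> edge_placement (V i) (P i) pl slot"
      and W: "W = (\<Union>i<m. V i)" and C: "C = node_code W \<alpha> pl slot A"
      and n: "n = card W" and k: "k = fvec.dim C"
    for P and V :: "nat \<Rightarrow> 'v set" and pl slot W C n k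
  proof -
    have code: "edge_code A {..<m * N\<^sub>L} m l r \<delta> n\<^sub>L K\<^sub>L \<alpha> V P pl slot"
      using assms(6-8,11,13,14) r \<delta> l K P V dmin_A \<Delta>
      by unfold_locales (auto simp: mds_decomposition_def)
    have params: "(n\<^sub>L - 1) * r - (r choose 2) = K\<^sub>L"
      using assms(7,8,10) by (simp add: mult.commute)
    have local_MBR: "MBR_code n\<^sub>L r d \<alpha> \<beta> K\<^sub>L (V i) (vpuncture C (V i))" if "i < m" for i
      using edge_code.local_MBR_code(1)[OF code that] assms(8,9) C W by simp
    have transfer: "repair_by_transfer_code n\<^sub>L r (V i) (vpuncture C (V i))" if "i < m" for i
    proof -
      have "vpuncture C (V i) = node_code (V i) (n\<^sub>L - 1) pl slot (puncture A (P i))"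
        using edge_code.vpuncture_C[OF code that] assms(7,8) C W by simp
      moreover have "card (P i) = n\<^sub>L choose 2" "mds_code (P i) K\<^sub>L (puncture A (P i))"
        using P that assms(11) by (auto simp: mds_decomposition_def)
      ultimately show ?thesis
        using V(2) that unfolding repair_by_transfer_code_def params by blast
    qed
    have n_eq: "n = m * n\<^sub>L" using edge_code.card_W[OF code] n W by simp
    have k_eq: "k = l * K\<^sub>L" using edge_code.dim_C[OF code] k C W by simp
    have dist: "vdmin C = (m - l) * n\<^sub>L + \<delta>" using edge_code.vdmin_C[OF code] C W by simp
    have ratio: "real k / real K\<^sub>L = real l" using k_eq K_pos by simp
    have n\<^sub>L: "real n\<^sub>L = real r + real \<delta> - 1" using assms(6) r by simp
    have "real (vdmin C) = (real m - real l) * real n\<^sub>L + real \<delta>"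
      using dist l(2) by (simp add: of_nat_diff)
    then have "real (vdmin C) = real n - real k / real K\<^sub>L * real r + 1
        - (real k / real K\<^sub>L - 1) * (real \<delta> - 1)"
      unfolding n_eq ratio of_nat_mult n\<^sub>L by (simp add: algebra_simps)
    moreover have "MBR_local_code r \<delta> d \<beta> K\<^sub>L W \<alpha> C m V"
      using edge_code.MBR_local_code_C[OF code] assms(8,9) C W by simp
    ultimately show ?thesis using local_MBR transfer n_eq k_eq dist by blast
  qed
  show ?thesis
    by (rule conjI[OF decomposition conjI[OF dmin_A]], intro allI impI) (rule node; assumption)
qed

end
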